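(* Let $X$ be a finite set, $d$ a distance function on $X$ of negative type, $f:2^X\to\mathbb{R}_{\ge0}$ a nonnegative monotone submodular function of curvature $c$ (given by a value oracle), and $M=(X,\mathcal{I})$ a matroid of rank $k$. Let $g(A)=d(A)+f(A)$, let $\mathrm{OPT}$ be a set maximizing $g$ over $\mathcal{I}$, and let $\lambda_d=\frac{d(\mathrm{OPT})}{g(\mathrm{OPT})}$, $\lambda_f=\frac{f(\mathrm{OPT})}{g(\mathrm{OPT})}$. Then for any $\epsilon>0$ there is an efficient algorithm returning a set $A\in\mathcal{I}$ with $$g(A)\ge\left(1-\lambda_d\frac{4}{k}-\lambda_f\frac{c}{e}-\epsilon\right)g(\mathrm{OPT}),$$ and moreover $1-\lambda_d\frac{4}{k}-\lambda_f\frac{c}{e}-\epsilon\ge 1-\max\{\frac{4}{k},\frac{c}{e}\}-\epsilon$.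
   Context: A distance function on $X$ is a symmetric $d:X\times X\to\mathbb{R}_{\ge0}$ with $d(a,a)=0$; it is of negative type if its matrix $D$ ($D_{a,b}=d(a,b)$) satisfies $x^TDx\le0$ for all $x\in\mathbb{R}^X$ with $\sum_a x_a=0$. For $A\subseteq X$, $d(A)=\sum_{\{a,b\}\subseteq A}d(a,b)$. The curvature of a monotone submodular $f$ is $c=1-\min_{x\in X}\frac{f(X)-f(X\setminus\{x\})}{f(\{x\})-f(\emptyset)}\in[0,1]$. *)

theory Defs
  imports Complex_Main "HOL-Computational_Algebra.Polynomial"
begin

section \<open>Distances, submodular functions, matroids\<close>

definition distance_on :: "'a set \<Rightarrow> ('a \<Rightarrow> 'a \<Rightarrow> real) \<Rightarrow> bool" where
  "distance_on X d \<longleftrightarrow>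
     (\<forall>a\<in>X. \<forall>b\<in>X. 0 \<le> d a b \<and> d a b = d b a) \<and> (\<forall>a\<in>X. d a a = 0)"

definition negative_type_on :: "'a set \<Rightarrow> ('a \<Rightarrow> 'a \<Rightarrow> real) \<Rightarrow> bool" where
  "negative_type_on X d \<longleftrightarrow>
     (\<forall>x::'a \<Rightarrow> real. (\<Sum>a\<in>X. x a) = 0 \<longrightarrow> (\<Sum>a\<in>X. \<Sum>b\<in>X. x a * d a b * x b) \<le> 0)"

text \<open>The sum of \<open>d a b\<close> over unordered pairs from \<open>A\<close>: the double sum meets every pair of
  distinct elements twice, and the diagonal terms of a distance function vanish.\<close>

definition dispersion :: "('a \<Rightarrow> 'a \<Rightarrow> real) \<Rightarrow> 'a set \<Rightarrow> real" where
  "dispersion d A = (\<Sum>a\<in>A. \<Sum>b\<in>A. d a b) / 2"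

definition submodular_on :: "'a set \<Rightarrow> ('a set \<Rightarrow> real) \<Rightarrow> bool" where
  "submodular_on X f \<longleftrightarrow>
     (\<forall>A B. A \<subseteq> X \<longrightarrow> B \<subseteq> X \<longrightarrow> f (A \<union> B) + f (A \<inter> B) \<le> f A + f B)"

text \<open>If \<open>f {x} = f {}\<close>, then by submodularity and monotonicity the quotient is \<open>0 / 0\<close>, which is
  read as \<open>1\<close>.  All quotients are at most \<open>1\<close>, so such \<open>x\<close> are left out of the minimum, and
  the curvature is \<open>0\<close> if nothing remains.\<close>

definition curvature :: "'a set \<Rightarrow> ('a set \<Rightarrow> real) \<Rightarrow> real" where
  "curvature X f =
     (let Y = {x \<in> X. f {x} \<noteq> f {}} in
      if Y = {} then 0
      else 1 - (MIN x\<in>Y. (f X - f (X - {x})) / (f {x} - f {})))"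

definition matroid :: "'a set \<Rightarrow> 'a set set \<Rightarrow> bool" where
  "matroid X \<I> \<longleftrightarrow>
     finite X \<and> \<I> \<subseteq> Pow X \<and> {} \<in> \<I> \<and>
     (\<forall>A B. B \<in> \<I> \<longrightarrow> A \<subseteq> B \<longrightarrow> A \<in> \<I>) \<and>
     (\<forall>A B. A \<in> \<I> \<longrightarrow> B \<in> \<I> \<longrightarrow> card A < card B \<longrightarrow> (\<exists>x\<in>B - A. insert x A \<in> \<I>))"

definition matroid_rank :: "'a set set \<Rightarrow> nat" where
  "matroid_rank \<I> = Max (card ` \<I>)"


section \<open>Real RAM programs with oracles\<close>

text \<open>
  Efficient algorithms are programs for a real RAM with oracles that halt within polynomially many
  steps.  A program works with named unbounded arrays of natural numbers (indices, flags, sets)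
  and named unbounded arrays of reals.  It sees a problem only through the number of ground
  elements, the distance matrix, the value oracle and the independence oracle.  Ground elements
  are the indices below the ground set size; a natural number array represents the set of those
  indices at which its entry is nonzero.

  Every assignment and every test costs one step.  Evaluating one expression takes a number of
  elementary operations bounded by a constant of the program.  Natural numbers can only be added
  and subtracted (truncated at \<open>0\<close>), so that their bit length is at most linear in the number of
  steps.  Reals support exact field operations and comparison; there is no rounding, and no real
  constant other than those that come from natural numbers.
\<close>

record problem =
  ground_size :: nat
  dist_entry :: "nat \<Rightarrow> nat \<Rightarrow> real"
  value_of :: "nat set \<Rightarrow> real"
  indep :: "nat set \<Rightarrow> bool"

type_synonym name = nat

record state =
  narr :: "name \<Rightarrow> nat \<Rightarrow> nat"
  rarr :: "name \<Rightarrow> nat \<Rightarrow> real"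

definition array_set :: "problem \<Rightarrow> state \<Rightarrow> name \<Rightarrow> nat set" where
  "array_set P s a = {i. i < ground_size P \<and> narr s a i \<noteq> 0}"

datatype nexp =
    NConst nat
  | NGroundSize
  | NGet name nexp
  | NAdd nexp nexp
  | NSub nexp nexp

datatype rexp =
    RNat nexp
  | RGet name nexp
  | RDist nexp nexp
  | RValue name  \<comment> \<open>value oracle, queried at the set given by an array\<close>
  | RAdd rexp rexp
  | RSub rexp rexp
  | RMul rexp rexp
  | RDiv rexp rexp

datatype bexp =
    NLess nexp nexp
  | RLess rexp rexp
  | BIndep name  \<comment> \<open>independence oracle, queried at the set given by an array\<close>
  | BNot bexp
  | BAnd bexp bexp

datatype com =
    Skip
  | NAssign name nexp nexp  \<comment> \<open>array, index, new entry\<close>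
  | RAssign name nexp rexp
  | Seq com com
  | If bexp com com
  | While bexp com

primrec nval :: "problem \<Rightarrow> state \<Rightarrow> nexp \<Rightarrow> nat" where
  "nval P s (NConst n) = n"
| "nval P s NGroundSize = ground_size P"
| "nval P s (NGet a i) = narr s a (nval P s i)"
| "nval P s (NAdd i j) = nval P s i + nval P s j"
| "nval P s (NSub i j) = nval P s i - nval P s j"

primrec rval :: "problem \<Rightarrow> state \<Rightarrow> rexp \<Rightarrow> real" where
  "rval P s (RNat i) = real (nval P s i)"
| "rval P s (RGet a i) = rarr s a (nval P s i)"
| "rval P s (RDist i j) =
     (if nval P s i < ground_size P \<and> nval P s j < ground_size P
      then dist_entry P (nval P s i) (nval P s j) else 0)"
| "rval P s (RValue a) = value_of P (array_set P s a)"
| "rval P s (RAdd x y) = rval P s x + rval P s y"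
| "rval P s (RSub x y) = rval P s x - rval P s y"
| "rval P s (RMul x y) = rval P s x * rval P s y"
| "rval P s (RDiv x y) = rval P s x / rval P s y"

primrec bval :: "problem \<Rightarrow> state \<Rightarrow> bexp \<Rightarrow> bool" where
  "bval P s (NLess i j) \<longleftrightarrow> nval P s i < nval P s j"
| "bval P s (RLess x y) \<longleftrightarrow> rval P s x < rval P s y"
| "bval P s (BIndep a) \<longleftrightarrow> indep P (array_set P s a)"
| "bval P s (BNot b) \<longleftrightarrow> \<not> bval P s b"
| "bval P s (BAnd b c) \<longleftrightarrow> bval P s b \<and> bval P s c"

definition nupdate :: "name \<Rightarrow> nat \<Rightarrow> nat \<Rightarrow> state \<Rightarrow> state" where
  "nupdate a i v s = s\<lparr>narr := (narr s)(a := (narr s a)(i := v))\<rparr>"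

definition rupdate :: "name \<Rightarrow> nat \<Rightarrow> real \<Rightarrow> state \<Rightarrow> state" where
  "rupdate a i v s = s\<lparr>rarr := (rarr s)(a := (rarr s a)(i := v))\<rparr>"

text \<open>\<open>exec P c s t s'\<close>: on problem \<open>P\<close>, command \<open>c\<close> started in \<open>s\<close> halts in \<open>s'\<close> after \<open>t\<close> steps.\<close>

inductive exec :: "problem \<Rightarrow> com \<Rightarrow> state \<Rightarrow> nat \<Rightarrow> state \<Rightarrow> bool" for P where
  Skip: "exec P Skip s 1 s"
| NAssign: "exec P (NAssign a i e) s 1 (nupdate a (nval P s i) (nval P s e) s)"
| RAssign: "exec P (RAssign a i e) s 1 (rupdate a (nval P s i) (rval P s e) s)"
| Seq: "exec P c1 s t1 s' \<Longrightarrow> exec P c2 s' t2 s'' \<Longrightarrow> exec P (Seq c1 c2) s (t1 + t2) s''"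
| IfTrue: "bval P s b \<Longrightarrow> exec P c1 s t s' \<Longrightarrow> exec P (If b c1 c2) s (Suc t) s'"
| IfFalse: "\<not> bval P s b \<Longrightarrow> exec P c2 s t s' \<Longrightarrow> exec P (If b c1 c2) s (Suc t) s'"
| WhileFalse: "\<not> bval P s b \<Longrightarrow> exec P (While b c) s 1 s"
| WhileTrue: "bval P s b \<Longrightarrow> exec P c s t1 s' \<Longrightarrow> exec P (While b c) s' t2 s'' \<Longrightarrow>
    exec P (While b c) s (Suc (t1 + t2)) s''"

inductive_cases exec_SkipE: "exec P Skip s t s'"
  and exec_NAssignE: "exec P (NAssign a i e) s t s'"
  and exec_RAssignE: "exec P (RAssign a i e) s t s'"
  and exec_SeqE: "exec P (Seq c1 c2) s t s'"
  and exec_IfE: "exec P (If b c1 c2) s t s'"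
  and exec_WhileE: "exec P (While b c) s t s'"

lemma exec_deterministic:
  "exec P c s t s' \<Longrightarrow> exec P c s u s'' \<Longrightarrow> u = t \<and> s'' = s'"
proof (induction arbitrary: u s'' rule: exec.induct)
  case Skip
  then show ?case by (rule exec_SkipE) simp
next
  case NAssign
  then show ?case by (rule exec_NAssignE) simp
next
  case RAssign
  then show ?case by (rule exec_RAssignE) simp
next
  case Seq
  from Seq.prems show ?case by (rule exec_SeqE) (use Seq.IH in blast)
next
  case IfTrue
  from IfTrue.prems show ?case by (rule exec_IfE) (use IfTrue.hyps IfTrue.IH in blast)+
next
  case IfFalse
  from IfFalse.prems show ?case by (rule exec_IfE) (use IfFalse.hyps IfFalse.IH in blast)+
next
  case WhileFalse
  from WhileFalse.prems show ?case by (rule exec_WhileE) (use WhileFalse.hyps in simp_all)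
next
  case WhileTrue
  from WhileTrue.prems show ?case
    by (rule exec_WhileE) (use WhileTrue.hyps WhileTrue.IH in blast)+
qed

definition initial_state :: state where
  "initial_state = \<lparr>narr = (\<lambda>_ _. 0), rarr = (\<lambda>_ _. 0)\<rparr>"

text \<open>The program returns the set given by array \<open>0\<close> of the final state.\<close>

definition returns_within :: "com \<Rightarrow> problem \<Rightarrow> nat \<Rightarrow> nat set \<Rightarrow> bool" where
  "returns_within c P T S \<longleftrightarrow>
     (\<exists>t s. exec P c initial_state t s \<and> t \<le> T \<and> S = array_set P s 0)"

text \<open>The problem as presented to a program when the ground set is enumerated by \<open>en\<close>.\<close>

definition encode ::
  "(nat \<Rightarrow> 'a) \<Rightarrow> 'a set \<Rightarrow> ('a \<Rightarrow> 'a \<Rightarrow> real) \<Rightarrow> ('a set \<Rightarrow> real) \<Rightarrow> 'a set set \<Rightarrow> problem" where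
  "encode en X d f \<I> =
     \<lparr>ground_size = card X,
      dist_entry = (\<lambda>i j. d (en i) (en j)),
      value_of = (\<lambda>S. f (en ` S)),
      indep = (\<lambda>S. en ` S \<in> \<I>)\<rparr>"

end

(* Deterministic non-oblivious local search.  A base A is kept together with a partition into m parts,
   and a swap removes a from A and puts b into one of the parts.  The potential of a partitioned base is
     k/(k+2) d(A) + l(A) + (sum over J of alpha_|J| g(A_J)),
   where A_J is the union of the parts in J, l(x) = f(X) - f(X - x) is the modular part of f that the
   curvature controls, and g = f - l is still monotone and submodular.  Along the exchange bijection from A
   to an optimal base B, averaged over all m parts, the three terms improve by at least
     (1 - 4/(k+2)) d(B) - d(A),   l(B) - l(A)   and   (1 - (m/(m+1))^m) g(B) - g(A);
   the first bound is where negative type enters.  Hence a current value that is too small forces a swap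
   with a large gain, and since the potential is at most (m+1) OPT, linearly many steepest ascent steps
   pass through a good base.  The partition into a constant number of parts replaces the sampling of the
   usual continuous potential, so that the algorithm is deterministic; (m/(m+1))^m tends to 1/e. *)

theory Submission
  imports Defs
begin

section \<open>Matroid exchange\<close>

text \<open>The three gains are scaled so that each carries its current value with coefficient -1;
  only then do they add up to a target minus d(A) + f(A). For the dispersion this forces the factor
  k/(k+2): negative type bounds k times the summed change below by (k-2) d(B) - (k+2) d(A), and
  (k-2)/(k+2) = 1 - 4/(k+2). Splitting off l lets the curvature in without the program ever
  computing it: l is gained in full, g loses the fraction (m/(m+1))^m, and g(B) is at most c f(B) +
  (1-c) f({}). Searching on f itself would not do, since a local optimum of a monotone submodular
  function may have only half of the optimal value; the mixture also rewards bases whose subsets are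
  good. As the potential is not the objective, a step may lower d(A) + f(A), so the best base met is
  recorded. The optimum is unknown, so no gain is tested for being large enough: the number of steps
  is fixed in advance, and the analysis compares with thresholds that the program never
  sees.\<close>

lemma matroid_finite: "matroid X \<I> \<Longrightarrow> A \<in> \<I> \<Longrightarrow> finite A"
  unfolding matroid_def using finite_subset by auto

lemma matroid_empty: "matroid X \<I> \<Longrightarrow> {} \<in> \<I>"
  by (simp add: matroid_def)

lemma matroid_subset: "matroid X \<I> \<Longrightarrow> A \<in> \<I> \<Longrightarrow> A \<subseteq> X"
  unfolding matroid_def by blast

lemma matroid_down: "matroid X \<I> \<Longrightarrow> B \<in> \<I> \<Longrightarrow> A \<subseteq> B \<Longrightarrow> A \<in> \<I>"
  unfolding matroid_def by blast

lemma matroid_exchange: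
  "matroid X \<I> \<Longrightarrow> A \<in> \<I> \<Longrightarrow> B \<in> \<I> \<Longrightarrow> card A < card B \<Longrightarrow> \<exists>x\<in>B - A. insert x A \<in> \<I>"
  unfolding matroid_def by simp

lemma matroid_augment:
  assumes M: "matroid X \<I>" and "A \<in> \<I>" "B \<in> \<I>" "card A \<le> card B"
  shows "\<exists>K\<in>\<I>. A \<subseteq> K \<and> K \<subseteq> A \<union> B \<and> card K = card B"
  using assms(2,4)
proof (induction "card B - card A" arbitrary: A)
  case 0
  then show ?case by auto
next
  case (Suc n)
  then have "card A < card B" by simp
  then obtain x where x: "x \<in> B - A" "insert x A \<in> \<I>"
    using matroid_exchange[OF M Suc.prems(1) assms(3)] by blast
  have c: "card (insert x A) = Suc (card A)"
    using x matroid_finite[OF M Suc.prems(1)] by simp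
  have "\<exists>K\<in>\<I>. insert x A \<subseteq> K \<and> K \<subseteq> insert x A \<union> B \<and> card K = card B"
    by (rule Suc.hyps(1)) (use Suc.hyps(2) c x \<open>card A < card B\<close> in auto)
  then show ?case using x by blast
qed

text \<open>Every element of the circuit that \<open>a\<close> closes with \<open>B\<close> may
  leave \<open>B\<close> in exchange for \<open>a\<close>. The rest of that circuit spans
  \<open>a\<close>, whereas \<open>A - {a}\<close> does not, so one of its elements enlarges
  \<open>A - {a}\<close>; that element serves as \<open>b\<close>.\<close>

lemma symmetric_exchange:
  assumes M: "matroid X \<I>" and A: "A \<in> \<I>" and B: "B \<in> \<I>" and card: "card A = card B"
    and maximal: "\<And>S. S \<in> \<I> \<Longrightarrow> card S \<le> card B" and a: "a \<in> A - B"
  shows "\<exists>b\<in>B - A. insert b (A - {a}) \<in> \<I> \<and> insert a (B - {b}) \<in> \<I>"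
proof -
  have fin: "finite A" "finite B" using A B M matroid_finite by auto
  have "insert a B \<notin> \<I>"
    using maximal[of "insert a B"] fin a by auto
  define F where "F = {D. D \<subseteq> B \<and> insert a D \<notin> \<I>}"
  have "finite F" unfolding F_def using fin by auto
  moreover have "B \<in> F" using \<open>insert a B \<notin> \<I>\<close> unfolding F_def by auto
  \<comment> \<open>By minimality, \<open>insert a D\<close> is the fundamental circuit of
    \<open>a\<close> in \<open>B\<close>.\<close>
  ultimately obtain D where D: "D \<in> F" and min: "\<And>E. E \<in> F \<Longrightarrow> E \<subseteq> D \<Longrightarrow> E = D"
    by (metis finite_has_minimal2)
  have DB: "D \<subseteq> B" and Da: "insert a D \<notin> \<I>" using D unfolding F_def by auto
  have swapB: "insert a (B - {b}) \<in> \<I>" if b: "b \<in> D" for b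
  proof -
    have "D - {b} \<notin> F" using min[of "D - {b}"] b by auto
    then have ind: "insert a (D - {b}) \<in> \<I>" using DB unfolding F_def by auto
    obtain K where K: "K \<in> \<I>" "insert a (D - {b}) \<subseteq> K" "K \<subseteq> insert a (D - {b}) \<union> B"
      "card K = card B"
      using matroid_augment[OF M ind B] maximal[OF ind] by auto
    have "b \<notin> K"
    proof
      assume "b \<in> K"
      then have "insert a D \<subseteq> K" using K(2) by auto
      then show False using matroid_down[OF M K(1)] Da by blast
    qed
    then have sub: "K \<subseteq> insert a (B - {b})" using K(3) DB by auto
    have "card (insert a (B - {b})) = card B"
      using fin a b DB card_Suc_Diff1[of B b] by auto
    then have "K = insert a (B - {b})"
      using sub K(4) fin by (intro card_subset_eq) auto
    then show ?thesis using K(1) by simp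
  qed
  have "D \<in> \<I>" using matroid_down[OF M B DB] .
  moreover have "card D \<le> card A" using card card_mono[OF fin(2) DB] by simp
  \<comment> \<open>\<open>K\<close> completes \<open>D\<close> inside \<open>D \<union> A\<close>
    and has to avoid \<open>a\<close>; exchanging from it into \<open>A - {a}\<close> can therefore
    only bring in an element of \<open>D\<close> outside \<open>A\<close>.\<close>
  ultimately obtain K where K: "K \<in> \<I>" "D \<subseteq> K" "K \<subseteq> D \<union> A" "card K = card A"
    using matroid_augment[OF M _ A] by blast
  have aK: "a \<notin> K"
  proof
    assume "a \<in> K"
    then have "insert a D \<subseteq> K" using K(2) by auto
    then show False using matroid_down[OF M K(1)] Da by blast
  qed
  have "A - {a} \<in> \<I>" using matroid_down[OF M A] by blast
  moreover have "card (A - {a}) < card K"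
    using K(4) fin a by (metis DiffD1 card_Diff1_less)
  ultimately obtain b where b: "b \<in> K - (A - {a})" "insert b (A - {a}) \<in> \<I>"
    using matroid_exchange[OF M _ K(1)] by blast
  have "b \<in> D" "b \<notin> A" using b aK K(3) by auto
  then show ?thesis using b swapB DB by blast
qed

text \<open>The symmetric exchange brings \<open>B\<close> closer to \<open>A\<close> while \<open>A\<close> stays put, so the exchanges
  found one after the other all refer to the same \<open>A\<close>.\<close>

lemma exchange_bijection:
  assumes M: "matroid X \<I>" and A: "A \<in> \<I>" and B: "B \<in> \<I>" and card: "card A = card B"
    and maximal: "\<And>S. S \<in> \<I> \<Longrightarrow> card S \<le> card B"
  shows "\<exists>\<pi>. bij_betw \<pi> A B \<and> (\<forall>a\<in>A. insert (\<pi> a) (A - {a}) \<in> \<I>) \<and> (\<forall>a\<in>A \<inter> B. \<pi> a = a)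
    \<and> (\<forall>a\<in>A - B. \<pi> a \<notin> A)"
  using B card maximal
proof (induction "card (A - B)" arbitrary: B)
  case 0
  have fin: "finite A" "finite B" using A 0 M matroid_finite by auto
  have "A - B = {}" using 0 fin by (simp del: Diff_eq_empty_iff)
  then have "A = B" using 0 fin by (intro card_subset_eq) auto
  then show ?case using A by (intro exI[of _ id]) (auto simp: insert_absorb bij_betw_def inj_on_def)
next
  case (Suc n)
  have fin: "finite A" "finite B" using A Suc M matroid_finite by auto
  then obtain a where a: "a \<in> A - B"
    using Suc.hyps(2) by (metis card.empty equals0I nat.distinct(1))
  obtain b where b: "b \<in> B - A" "insert b (A - {a}) \<in> \<I>" "insert a (B - {b}) \<in> \<I>"
    using symmetric_exchange[OF M A Suc.prems(1,2) Suc.prems(3) a] by blast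
  define B' where "B' = insert a (B - {b})"
  have cB: "card B' = card B"
    using fin a b card_Suc_Diff1[of B b] unfolding B'_def by simp
  have eq: "A - B' = (A - B) - {a}" using a b unfolding B'_def by auto
  have "card (A - B') = n" using Suc.hyps(2) a unfolding eq by simp
  then obtain \<pi> where \<pi>: "bij_betw \<pi> A B'" "\<And>a. a \<in> A \<Longrightarrow> insert (\<pi> a) (A - {a}) \<in> \<I>"
      "\<And>a. a \<in> A \<inter> B' \<Longrightarrow> \<pi> a = a" "\<And>a. a \<in> A - B' \<Longrightarrow> \<pi> a \<notin> A"
    using Suc.hyps(1)[of B'] b(3) cB Suc.prems unfolding B'_def by auto
  \<comment> \<open>\<open>a\<close> lies in \<open>B'\<close>, so it is a fixed point; redirecting
    it to \<open>b\<close> makes \<open>\<pi>\<close> a bijection onto \<open>B\<close>.\<close>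
  have \<pi>a: "\<pi> a = a" using \<pi>(3) a B'_def by auto
  have "bij_betw \<pi> (A - {a}) (B' - {a})"
    using \<pi>(1) \<pi>a a unfolding B'_def by (intro bij_betw_DiffI) (auto intro: bij_betw_singletonI)
  moreover have "B' - {a} = B - {b}" using a b unfolding B'_def by auto
  ultimately have "bij_betw (\<pi>(a := b)) (A - {a}) (B - {b})"
    by (subst bij_betw_cong[of _ _ \<pi>]) auto
  then have "bij_betw (\<pi>(a := b)) (insert a (A - {a})) (insert b (B - {b}))"
    using notIn_Un_bij_betw3[of a "A - {a}" "\<pi>(a := b)" "B - {b}"] by simp
  then have bij: "bij_betw (\<pi>(a := b)) A B"
    using a b by (simp add: insert_absorb)
  have "(\<pi>(a := b)) x \<notin> A" if "x \<in> A - B" for x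
    using that \<pi>(4)[of x] b a unfolding B'_def by (cases "x = a") auto
  moreover have "(\<pi>(a := b)) x = x" if "x \<in> A \<inter> B" for x
    using that \<pi>(3)[of x] b a unfolding B'_def by (cases "x = b") auto
  moreover have "insert ((\<pi>(a := b)) x) (A - {x}) \<in> \<I>" if "x \<in> A" for x
    using that \<pi>(2)[of x] b by (cases "x = a") auto
  ultimately show ?case using bij by (intro exI[of _ "\<pi>(a := b)"]) blast
qed

section \<open>Dispersion of exchanges\<close>

definition cross :: "('a \<Rightarrow> 'a \<Rightarrow> real) \<Rightarrow> 'a set \<Rightarrow> 'a set \<Rightarrow> real" where
  "cross d A B = (\<Sum>a\<in>A. \<Sum>b\<in>B. d a b)"

lemma dispersion_cross: "dispersion d A = cross d A A / 2"
  by (simp add: dispersion_def cross_def)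

lemma cross_sym:
  assumes "distance_on X d" "A \<subseteq> X" "B \<subseteq> X"
  shows "cross d A B = cross d B A"
  unfolding cross_def
  by (subst sum.swap) (intro sum.cong refl, use assms in \<open>auto simp: distance_on_def subset_iff\<close>)

context
  fixes X :: "'a set" and d :: "'a \<Rightarrow> 'a \<Rightarrow> real"
  assumes fin: "finite X"
begin

text \<open>Negative type says that \<open>form u u\<close> is nonpositive for every
  \<open>u\<close> with zero sum. Sets enter as indicator vectors, so each distance inequality below
  amounts to the choice of a test vector.\<close>

definition form :: "('a \<Rightarrow> real) \<Rightarrow> ('a \<Rightarrow> real) \<Rightarrow> real" where
  "form x y = (\<Sum>a\<in>X. \<Sum>b\<in>X. x a * d a b * y b)"

lemma form_add: "form (\<lambda>a. x a + y a) z = form x z + form y z"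
  "form z (\<lambda>a. x a + y a) = form z x + form z y"
  by (simp_all add: form_def algebra_simps sum.distrib)

lemma form_diff: "form (\<lambda>a. x a - y a) z = form x z - form y z"
  "form z (\<lambda>a. x a - y a) = form z x - form z y"
  by (simp_all add: form_def algebra_simps sum_subtractf)

lemma form_scale: "form (\<lambda>a. x a / c) z = form x z / c" "form z (\<lambda>a. x a / c) = form z x / c"
  by (simp_all add: form_def sum_divide_distrib)

lemma form_indicator:
  assumes "A \<subseteq> X" "B \<subseteq> X"
  shows "form (\<lambda>a. of_bool (a \<in> A)) (\<lambda>a. of_bool (a \<in> B)) = cross d A B"
proof -
  have "(\<Sum>b\<in>X. of_bool (a \<in> A) * d a b * of_bool (b \<in> B)) = of_bool (a \<in> A) * (\<Sum>b\<in>B. d a b)" for a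
  proof -
    have "(\<Sum>b\<in>X. of_bool (a \<in> A) * d a b * of_bool (b \<in> B)) = (\<Sum>b\<in>B. of_bool (a \<in> A) * d a b)"
      using assms fin by (intro sum.mono_neutral_cong_right) auto
    then show ?thesis by (simp add: sum_distrib_left)
  qed
  then show ?thesis
    unfolding form_def cross_def using assms fin
    by (auto simp: of_bool_def intro!: sum.mono_neutral_cong_right)
qed

lemma form_sym:
  assumes "distance_on X d"
  shows "form x y = form y x"
  unfolding form_def
  by (subst sum.swap) (intro sum.cong refl, use assms in \<open>auto simp: distance_on_def\<close>)

lemma sum_indicator:
  "A \<subseteq> X \<Longrightarrow> (\<Sum>x\<in>X. of_bool (x \<in> A)) = real (card A)"
  using fin by (simp add: Int_absorb1 of_bool_def flip: sum.inter_restrict)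

text \<open>Negative type is applied to the difference of the two indicator vectors, whose sum
  vanishes because the sets have equal size.\<close>

lemma cross_ge_dispersion:
  assumes d: "distance_on X d" "negative_type_on X d"
    and sub: "A \<subseteq> X" "B \<subseteq> X" and card: "card A = card B"
  shows "dispersion d A + dispersion d B \<le> cross d A B"
proof -
  define u where "u = (\<lambda>x. of_bool (x \<in> A) - of_bool (x \<in> B) :: real)"
  have "(\<Sum>x\<in>X. u x) = 0"
    unfolding u_def using sub card by (simp add: sum_subtractf sum_indicator)
  then have "form u u \<le> 0"
    using d(2) unfolding negative_type_on_def form_def by blast
  moreover have "form u u = cross d A A + cross d B B - 2 * cross d A B"
    unfolding u_def using sub cross_sym[OF d(1) sub] by (simp add: form_diff form_indicator)
  ultimately show ?thesis by (simp add: dispersion_cross field_simps)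
qed

text \<open>In a Euclidean embedding with squared distances \<open>d\<close> and the centroids of \<open>A\<close> and \<open>B\<close>
  subtracted, matched points satisfy \<open>\<bar>a + b\<bar>\<^sup>2 \<ge> 0\<close>; this is the sum of these inequalities.\<close>

lemma sum_matched_distances:
  assumes d: "distance_on X d" "negative_type_on X d"
    and sub: "A \<subseteq> X" "B \<subseteq> X" and \<pi>: "bij_betw \<pi> A B" and k: "k = real (card A)" "k > 0"
  shows "k * (\<Sum>a\<in>A. d a (\<pi> a)) \<le> dispersion d A + dispersion d B + cross d A B"
proof -
  have cB: "card B = card A" using bij_betw_same_card[OF \<pi>] by simp
  define e where "e = (\<lambda>(S :: 'a set) x. of_bool (x \<in> S) :: real)"
  \<comment> \<open>\<open>u\<close> is the sum of the two centroids and has total mass 2, so the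
    indicators of \<open>a\<close> and \<open>\<pi> a\<close> minus \<open>u\<close> form a test
    vector with zero sum.\<close>
  define u where "u = (\<lambda>x. (e A x + e B x) / k)"
  have form_e: "form (e S) (e T) = cross d S T" if "S \<subseteq> X" "T \<subseteq> X" for S T
    unfolding e_def using that by (rule form_indicator)
  define N where "N = cross d A A + 2 * cross d A B + cross d B B"
  have BA: "cross d B A = cross d A B" using cross_sym[OF d(1) sub] by simp
  have uu: "form u u = N / k\<^sup>2"
    unfolding u_def form_scale form_add using sub BA
    by (simp add: form_e N_def power2_eq_square add_divide_distrib)
  have one: "2 * d a (\<pi> a) - 2 * (form (e {a}) u + form (e {\<pi> a}) u) + N / k\<^sup>2 \<le> 0"
    if a: "a \<in> A" for a
  proof -
    define v where "v = (\<lambda>x. (e {a} x + e {\<pi> a} x) - u x)"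
    have aX: "a \<in> X" "\<pi> a \<in> X" using a sub \<pi> by (auto simp: bij_betw_def)
    have sum_e: "(\<Sum>x\<in>X. e S x) = card S" if "S \<subseteq> X" for S
      unfolding e_def using sum_indicator[OF that] .
    have "(\<Sum>x\<in>X. v x) = 1 + 1 - (k + k) / k"
      unfolding v_def u_def using aX sub cB k
      by (simp add: sum_subtractf sum.distrib sum_e flip: sum_divide_distrib)
    then have "(\<Sum>x\<in>X. v x) = 0" using k by (simp add: field_simps)
    then have "form v v \<le> 0"
      using d(2) unfolding negative_type_on_def form_def by blast
    moreover have "form v v = d a a + d a (\<pi> a) + d (\<pi> a) a + d (\<pi> a) (\<pi> a)
        - 2 * (form (e {a}) u + form (e {\<pi> a}) u) + form u u"
      unfolding v_def form_diff form_add using aX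
      by (simp add: form_e form_sym[OF d(1), of u "e {a}"] form_sym[OF d(1), of u "e {\<pi> a}"] cross_def)
    moreover have "d a a = 0" "d (\<pi> a) (\<pi> a) = 0" "d (\<pi> a) a = d a (\<pi> a)"
      using d(1) aX unfolding distance_on_def by auto
    ultimately show ?thesis by (simp add: uu)
  qed
  have e_u: "form (e {x}) u = (cross d {x} A + cross d {x} B) / k" if "x \<in> X" for x
    unfolding u_def form_scale form_add using sub that by (simp add: form_e)
  have "(\<Sum>a\<in>A. form (e {a}) u) = (\<Sum>a\<in>A. (cross d {a} A + cross d {a} B) / k)"
    using sub by (intro sum.cong refl e_u) auto
  also have "\<dots> = (cross d A A + cross d A B) / k"
    by (simp add: cross_def sum.distrib flip: sum_divide_distrib)
  finally have sA: "(\<Sum>a\<in>A. form (e {a}) u) = (cross d A A + cross d A B) / k" .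
  have "(\<Sum>a\<in>A. form (e {\<pi> a}) u) = (\<Sum>b\<in>B. form (e {b}) u)"
    using \<pi> by (rule sum.reindex_bij_betw)
  also have "\<dots> = (\<Sum>b\<in>B. (cross d {b} A + cross d {b} B) / k)"
    using sub by (intro sum.cong refl e_u) auto
  also have "\<dots> = (cross d A B + cross d B B) / k"
    using BA by (simp add: cross_def sum.distrib flip: sum_divide_distrib)
  finally have sB: "(\<Sum>a\<in>A. form (e {\<pi> a}) u) = (cross d A B + cross d B B) / k" .
  have "(\<Sum>a\<in>A. 2 * d a (\<pi> a) - 2 * (form (e {a}) u + form (e {\<pi> a}) u) + N / k\<^sup>2) \<le> 0"
    using one by (rule sum_nonpos)
  then have "2 * (\<Sum>a\<in>A. d a (\<pi> a)) - 2 * ((cross d A A + cross d A B) / k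
      + (cross d A B + cross d B B) / k) + k * (N / k\<^sup>2) \<le> 0"
    unfolding sum.distrib sum_subtractf sum_distrib_left[symmetric] sA sB by (simp add: k(1))
  moreover have "(cross d A A + cross d A B) / k + (cross d A B + cross d B B) / k = N / k"
    by (simp add: N_def add_divide_distrib)
  ultimately have "2 * (\<Sum>a\<in>A. d a (\<pi> a)) - 2 * (N / k) + k * (N / k\<^sup>2) \<le> 0"
    by simp
  then have "2 * (\<Sum>a\<in>A. d a (\<pi> a)) \<le> N / k"
    using k(2) by (simp add: power2_eq_square)
  then show ?thesis
    using k(2) unfolding N_def dispersion_cross by (simp add: field_simps)
qed

lemma dispersion_insert:
  assumes d: "distance_on X d" and S: "insert x S \<subseteq> X" "x \<notin> S"
  shows "dispersion d (insert x S) = dispersion d S + cross d {x} S"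
proof -
  have fS: "finite S" using S fin finite_subset by auto
  have "cross d S {x} = cross d {x} S" using S by (intro cross_sym[OF d]) auto
  moreover have "d x x = 0" using d S unfolding distance_on_def by auto
  ultimately show ?thesis
    using fS S(2) unfolding dispersion_cross by (simp add: cross_def sum.distrib)
qed

text \<open>A swap replaces the distances from \<open>a\<close> to \<open>A\<close> by those from
  \<open>\<pi> a\<close>, except for \<open>d a (\<pi> a)\<close>, because \<open>a\<close> has
  left. The sum over all swaps is \<open>cross d A B\<close> minus twice the dispersion of
  \<open>A\<close>, minus the matched distances, which \<open>sum_matched_distances\<close> limits
  to a 1/k share.\<close>

lemma sum_dispersion_swaps:
  assumes d: "distance_on X d" "negative_type_on X d"
    and sub: "A \<subseteq> X" "B \<subseteq> X" and \<pi>: "bij_betw \<pi> A B" and k: "k = real (card A)" "k > 0"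
    and new: "\<And>a. a \<in> A \<Longrightarrow> \<pi> a = a \<or> \<pi> a \<notin> A"
  shows "(1 - 4 / (k + 2)) * dispersion d B - dispersion d A
    \<le> k / (k + 2) * (\<Sum>a\<in>A. dispersion d (insert (\<pi> a) (A - {a})) - dispersion d A)"
proof -
  have fA: "finite A" using sub fin finite_subset by auto
  have one: "dispersion d (insert (\<pi> a) (A - {a})) - dispersion d A
      = cross d {\<pi> a} A - cross d {a} A - d a (\<pi> a)" if a: "a \<in> A" for a
  proof -
    have aX: "a \<in> X" "\<pi> a \<in> X" using a sub \<pi> by (auto simp: bij_betw_def)
    have "dispersion d (insert (\<pi> a) (A - {a})) = dispersion d (A - {a}) + cross d {\<pi> a} (A - {a})"
      using new[OF a] aX sub by (intro dispersion_insert[OF d(1)]) auto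
    moreover have "dispersion d (insert a (A - {a})) = dispersion d (A - {a}) + cross d {a} (A - {a})"
      using aX sub by (intro dispersion_insert[OF d(1)]) auto
    moreover have "cross d {x} A = cross d {x} (A - {a}) + d x a" for x
      using fA a by (simp add: cross_def sum.remove[of A a])
    moreover have "d a a = 0" "d (\<pi> a) a = d a (\<pi> a)"
      using d(1) aX unfolding distance_on_def by auto
    ultimately show ?thesis using a by (simp add: insert_absorb)
  qed
  have "(\<Sum>a\<in>A. cross d {\<pi> a} A) = (\<Sum>b\<in>B. cross d {b} A)"
    using \<pi> by (rule sum.reindex_bij_betw)
  then have s1: "(\<Sum>a\<in>A. cross d {\<pi> a} A) = cross d A B"
    using cross_sym[OF d(1) sub] by (simp add: cross_def)
  have s2: "(\<Sum>a\<in>A. cross d {a} A) = 2 * dispersion d A"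
    by (simp add: dispersion_cross cross_def)
  define G where "G = (\<Sum>a\<in>A. dispersion d (insert (\<pi> a) (A - {a})) - dispersion d A)"
  define s where "s = (\<Sum>a\<in>A. d a (\<pi> a))"
  have "G = (\<Sum>a\<in>A. cross d {\<pi> a} A - cross d {a} A - d a (\<pi> a))"
    unfolding G_def using one by (intro sum.cong) auto
  then have G: "G = cross d A B - 2 * dispersion d A - s"
    by (simp add: sum_subtractf s1 s2 s_def)
  have ks: "k * s \<le> dispersion d A + dispersion d B + cross d A B"
    unfolding s_def using sum_matched_distances[OF d sub \<pi> k] .
  have "1 \<le> k" using k by simp
  have "card A = card B" using bij_betw_same_card[OF \<pi>] .
  \<comment> \<open>Of the \<open>k\<close> copies of \<open>cross d A B\<close> in
    \<open>k * G\<close>, one cancels against the bound on \<open>k * s\<close>; the other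
    \<open>k - 1\<close> are estimated by \<open>cross_ge_dispersion\<close>.\<close>
  then have "(k - 1) * (dispersion d A + dispersion d B) \<le> (k - 1) * cross d A B"
    using \<open>1 \<le> k\<close> cross_ge_dispersion[OF d sub] by (intro mult_left_mono) auto
  then have "(k - 2) * dispersion d B - (k + 2) * dispersion d A \<le> k * G"
    using ks unfolding G by (simp add: algebra_simps)
  then have "((k - 2) * dispersion d B - (k + 2) * dispersion d A) / (k + 2) \<le> k * G / (k + 2)"
    using k by (intro divide_right_mono) auto
  moreover have "((k - 2) * dispersion d B - (k + 2) * dispersion d A) / (k + 2)
      = (1 - 4 / (k + 2)) * dispersion d B - dispersion d A"
    using k by (simp add: field_simps)
  ultimately show ?thesis unfolding G_def by simp
qed

end

section \<open>Submodular functions\<close>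

lemma submodularD:
  "submodular_on X f \<Longrightarrow> A \<subseteq> X \<Longrightarrow> B \<subseteq> X \<Longrightarrow> f (A \<union> B) + f (A \<inter> B) \<le> f A + f B"
  unfolding submodular_on_def by blast

text \<open>Diminishing returns: losing \<open>s\<close> from all of \<open>T\<close> costs at most
  what it costs after \<open>S\<close> is gone, and the latter costs telescope.\<close>

lemma sum_removals_le:
  assumes f: "submodular_on X f" and T: "T \<subseteq> X" and "finite S" "S \<subseteq> T"
  shows "(\<Sum>a\<in>S. f T - f (T - {a})) \<le> f T - f (T - S)"
  using assms(3,4)
proof (induction S)
  case empty
  then show ?case by simp
next
  case (insert s S)
  have "f ((T - S) \<union> (T - {s})) + f ((T - S) \<inter> (T - {s})) \<le> f (T - S) + f (T - {s})"
    using T by (intro submodularD[OF f]) auto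
  moreover have "(T - S) \<union> (T - {s}) = T" "(T - S) \<inter> (T - {s}) = T - insert s S"
    using insert by auto
  ultimately show ?case using insert by simp
qed

lemma sum_additions_ge:
  assumes f: "submodular_on X f" and T: "T \<subseteq> X" and "finite B" "B \<subseteq> X"
  shows "f (T \<union> B) - f T \<le> (\<Sum>b\<in>B. f (insert b T) - f T)"
  using assms(3,4)
proof (induction B)
  case empty
  then show ?case by simp
next
  case (insert b B)
  have "f (T \<union> insert b B) - f (T \<union> B) \<le> f (insert b T) - f T"
  proof (cases "b \<in> T")
    case True
    then show ?thesis by (simp add: insert_absorb)
  next
    case False
    have "f ((T \<union> B) \<union> insert b T) + f ((T \<union> B) \<inter> insert b T) \<le> f (T \<union> B) + f (insert b T)"
      using insert T by (intro submodularD[OF f]) auto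
    moreover have "(T \<union> B) \<union> insert b T = T \<union> insert b B" "(T \<union> B) \<inter> insert b T = T"
      using insert False by auto
    ultimately show ?thesis by simp
  qed
  then show ?case using insert by simp
qed

section \<open>Marginals, residual and curvature\<close>

definition marginal :: "'a set \<Rightarrow> ('a set \<Rightarrow> real) \<Rightarrow> 'a \<Rightarrow> real" where
  "marginal X f x = f X - f (X - {x})"

lemma marginal_nonneg: "mono_on (Pow X) f \<Longrightarrow> 0 \<le> marginal X f x"
  unfolding marginal_def by (auto simp: mono_on_def)

text \<open>The marginal at \<open>X\<close> is the least that \<open>x\<close> ever contributes, so
  it is at most the loss when \<open>x\<close> leaves \<open>T\<close>. This keeps the modular part
  below the increments of \<open>f\<close>, which is why the residual stays monotone.\<close>

lemma sum_marginal_le: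
  assumes f: "submodular_on X f" and fin: "finite X" and ST: "S \<subseteq> T" "T \<subseteq> X"
  shows "(\<Sum>x\<in>S. marginal X f x) \<le> f T - f (T - S)"
proof -
  have "(\<Sum>x\<in>S. marginal X f x) \<le> (\<Sum>x\<in>S. f T - f (T - {x}))"
  proof (rule sum_mono)
    fix x assume "x \<in> S"
    then have "T \<union> (X - {x}) = X" "T \<inter> (X - {x}) = T - {x}" using ST by auto
    then show "marginal X f x \<le> f T - f (T - {x})"
      using submodularD[OF f, of T "X - {x}"] ST by (auto simp: marginal_def)
  qed
  also have "\<dots> \<le> f T - f (T - S)"
    using ST finite_subset[OF _ fin, of S] by (intro sum_removals_le[OF f]) auto
  finally show ?thesis .
qed

definition residual :: "'a set \<Rightarrow> ('a set \<Rightarrow> real) \<Rightarrow> 'a set \<Rightarrow> real" where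
  "residual X f S = f S - (\<Sum>x\<in>S. marginal X f x)"

lemma residual_mono:
  assumes "submodular_on X f" and fin: "finite X"
  shows "mono_on (Pow X) (residual X f)"
proof (rule mono_onI)
  fix S T assume "S \<in> Pow X" "T \<in> Pow X" and ST: "S \<subseteq> T"
  then have "finite T" using fin finite_subset by auto
  then have "(\<Sum>x\<in>T. marginal X f x) = (\<Sum>x\<in>S. marginal X f x) + (\<Sum>x\<in>T - S. marginal X f x)"
    using ST by (metis add.commute sum.subset_diff)
  moreover have "(\<Sum>x\<in>T - S. marginal X f x) \<le> f T - f (T - (T - S))"
    using \<open>T \<in> Pow X\<close> by (intro sum_marginal_le[OF assms]) auto
  ultimately show "residual X f S \<le> residual X f T"
    using ST by (simp add: residual_def double_diff)
qed

lemma residual_submodular: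
  assumes "submodular_on X f" and fin: "finite X"
  shows "submodular_on X (residual X f)"
  unfolding submodular_on_def
proof (intro allI impI)
  fix A B assume AB: "A \<subseteq> X" "B \<subseteq> X"
  then have "finite A" "finite B" using fin finite_subset by auto
  then have "(\<Sum>x\<in>A \<union> B. marginal X f x) + (\<Sum>x\<in>A \<inter> B. marginal X f x)
      = (\<Sum>x\<in>A. marginal X f x) + (\<Sum>x\<in>B. marginal X f x)"
    by (rule sum.union_inter)
  then show "residual X f (A \<union> B) + residual X f (A \<inter> B) \<le> residual X f A + residual X f B"
    using submodularD[OF assms(1) AB] by (simp add: residual_def)
qed

text \<open>Monotonicity and submodularity put every quotient between 0 and 1, as adding
  \<open>x\<close> last gains at most what adding it first does. Elements with
  \<open>f {x} = f {}\<close> are absent from the minimum; for them the third bound has 0 on the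
  left.\<close>

lemma curvature_bounds:
  assumes fin: "finite X" and mono: "mono_on (Pow X) f" and sm: "submodular_on X f"
  shows "0 \<le> curvature X f" "curvature X f \<le> 1"
    "\<And>x. x \<in> X \<Longrightarrow> (1 - curvature X f) * (f {x} - f {}) \<le> marginal X f x"
proof -
  define Y where "Y = {x \<in> X. f {x} \<noteq> f {}}"
  define R where "R = (\<lambda>x. (f X - f (X - {x})) / (f {x} - f {}))"
  have fY: "finite Y" unfolding Y_def using fin by auto
  have c: "curvature X f = (if Y = {} then 0 else 1 - Min (R ` Y))"
    unfolding curvature_def Y_def R_def by (simp add: Let_def)
  have pos: "f {x} - f {} > 0" if "x \<in> Y" for x
  proof -
    have "f {} \<le> f {x}" by (rule mono_onD[OF mono]) (use that in \<open>auto simp: Y_def\<close>)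
    then show ?thesis using that by (auto simp: Y_def)
  qed
  have R0: "0 \<le> R x" if "x \<in> Y" for x
    using pos[OF that] marginal_nonneg[OF mono, of x] unfolding R_def marginal_def by simp
  have R1: "R x \<le> 1" if "x \<in> Y" for x
  proof -
    have "f ({x} \<union> (X - {x})) + f ({x} \<inter> (X - {x})) \<le> f {x} + f (X - {x})"
      using that by (intro submodularD[OF sm]) (auto simp: Y_def)
    moreover have "{x} \<union> (X - {x}) = X" using that by (auto simp: Y_def)
    ultimately show ?thesis using pos[OF that] unfolding R_def by simp
  qed
  show "0 \<le> curvature X f"
  proof (cases "Y = {}")
    case False
    then obtain x where "x \<in> Y" by auto
    then have "Min (R ` Y) \<le> R x" using fY by auto
    then show ?thesis using R1[OF \<open>x \<in> Y\<close>] c False by simp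
  qed (simp add: c)
  show "curvature X f \<le> 1"
    using c R0 fY by (auto simp: Min_ge_iff)
  show "(1 - curvature X f) * (f {x} - f {}) \<le> marginal X f x" if x: "x \<in> X" for x
  proof (cases "x \<in> Y")
    case True
    then have "1 - curvature X f \<le> R x" using c fY by auto
    then have "(1 - curvature X f) * (f {x} - f {}) \<le> R x * (f {x} - f {})"
      using pos[OF True] by (intro mult_right_mono) auto
    then show ?thesis using pos[OF True] by (simp add: R_def marginal_def)
  next
    case False
    then show ?thesis using x marginal_nonneg[OF mono, of x] by (simp add: Y_def)
  qed
qed

text \<open>Written for the residual, the bound reads: \<open>residual X f B\<close> is at most c
  f(B) + (1 - c) f({}), with c the curvature. Only this part of f(B) suffers the loss factor of the
  mixture.\<close>

lemma sum_marginal_ge_curvature: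
  assumes fin: "finite X" and mono: "mono_on (Pow X) f" and sm: "submodular_on X f"
    and B: "B \<subseteq> X"
  shows "(1 - curvature X f) * (f B - f {}) \<le> (\<Sum>x\<in>B. marginal X f x)"
proof -
  have "f ({} \<union> B) - f {} \<le> (\<Sum>b\<in>B. f (insert b {}) - f {})"
    using B fin finite_subset by (intro sum_additions_ge[OF sm]) auto
  then have "(1 - curvature X f) * (f B - f {}) \<le> (1 - curvature X f) * (\<Sum>b\<in>B. f {b} - f {})"
    using curvature_bounds(2)[OF assms(1-3)] by (intro mult_left_mono) auto
  also have "\<dots> \<le> (\<Sum>x\<in>B. marginal X f x)"
    unfolding sum_distrib_left
    by (intro sum_mono curvature_bounds(3)[OF assms(1-3)]) (use B in auto)
  finally show ?thesis .
qed

section \<open>The non-oblivious potential\<close>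

text \<open>The weights solve the recurrence \<open>t (m + 1) \<alpha>\<^sub>t = m (m - t) \<alpha>\<^sub>t\<^sub>+\<^sub>1\<close>, which makes the contributions
  of all \<open>J\<close> other than \<open>{}\<close> and \<open>{1..m}\<close> cancel in \<open>mixture_swaps\<close>, with \<open>\<alpha>\<^sub>m = 1 / (m + 1)\<close>.
  Since \<open>x / 0 = 0\<close>, \<open>\<alpha>\<^sub>0 = 0\<close>.\<close>

definition weight :: "nat \<Rightarrow> nat \<Rightarrow> real" where
  "weight m t = real (m ^ (m + 1 - t)) / real ((m + 1) ^ (m + 1 - t) * (t * (m choose t)))"

definition decay :: "nat \<Rightarrow> real" where
  "decay m = (real m / real (m + 1)) ^ m"

lemma weight_nonneg: "0 \<le> weight m t"
  by (simp add: weight_def)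

lemma weight_0: "weight m 0 = 0"
  by (simp add: weight_def)

text \<open>Absorption turns \<open>Suc t * (m choose Suc t)\<close> into \<open>m\<close> times the
  number of label sets of that size containing a given label. Each size thus contributes one term of
  a geometric series to \<open>sum_weight_containing\<close>.\<close>

lemma weight_Suc:
  assumes "t < m"
  shows "weight m (Suc t) = (real m / real (m + 1)) ^ (m - t) / (m * (m - 1 choose t))"
proof -
  have "Suc t * (m choose Suc t) = m * (m - 1 choose t)"
    using Suc_times_binomial[of t "m - 1"] assms by simp
  then show ?thesis unfolding weight_def using assms
    by (simp only: of_nat_mult of_nat_power diff_Suc_Suc add_Suc_right add_0_right power_divide
        One_nat_def) (simp add: field_simps)
qed

lemma weight_recurrence:
  assumes "0 < t" "t < m"
  shows "real t * real (m + 1) * weight m t = real m * real (m - t) * weight m (t + 1)"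
proof -
  obtain s where s: "t = Suc s" using assms by (cases t) auto
  define r where "r = real m / real (m + 1)"
  have "Suc s * (m - 1 choose Suc s) = (m - 1 - s) * (m - 1 choose s)"
    using binomial_absorb_comp[of "m - 1" s] binomial_absorption[of s "m - 1"] by simp
  then have b: "real t * real (m - 1 choose t) = real (m - t) * real (m - 1 choose s)"
    unfolding s by (metis diff_Suc_eq_diff_pred of_nat_mult)
  define u where "u = real (m - t)"
  have pos: "0 < real (m - 1 choose t)" "0 < real (m - 1 choose s)"
    using assms s by simp_all
  have "m - s = Suc (m - t)" using assms s by simp
  then have "real t * real (m + 1) * weight m t
      = real t * (real (m + 1) * r) * r ^ (m - t) / (m * (m - 1 choose s))"
    using weight_Suc[of s m] assms s by (simp add: r_def)
  also have "real (m + 1) * r = m" unfolding r_def by simp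
  also have "real t * real m * r ^ (m - t) / (m * (m - 1 choose s))
      = real m * real (m - t) * (r ^ (m - t) / (m * (m - 1 choose t)))"
    using b pos assms unfolding u_def[symmetric] by (simp add: field_simps)
  finally show ?thesis using weight_Suc[of t m] assms by (simp add: r_def)
qed

lemma weight_last: "0 < m \<Longrightarrow> weight m m = 1 / real (m + 1)"
  using weight_Suc[of "m - 1" m] by simp

lemma weight_first: "0 < m \<Longrightarrow> real m * weight m 1 = decay m"
  using weight_Suc[of 0 m] by (simp add: decay_def)

lemma sum_Pow_card:
  fixes F :: "nat \<Rightarrow> real"
  assumes "finite K"
  shows "(\<Sum>J\<in>Pow K. F (card J)) = (\<Sum>t\<le>card K. (card K choose t) * F t)"
proof -
  have "(\<Sum>J\<in>Pow K. F (card J)) = (\<Sum>t\<le>card K. \<Sum>J\<in>{J \<in> Pow K. card J = t}. F (card J))"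
    using assms by (intro sum.group[symmetric]) (auto intro: card_mono)
  also have "\<dots> = (\<Sum>t\<le>card K. (card K choose t) * F t)"
    using n_subsets[OF assms] by (intro sum.cong) auto
  finally show ?thesis .
qed

text \<open>The sets of size t + 1 that contain \<open>i\<close> have total weight
  \<open>r ^ (m - t) / m\<close>, and \<open>r / m = 1 - r\<close> sums the series to
  \<open>1 - r ^ m\<close>. The value is the factor with which a mixture reproduces a modular
  function.\<close>

lemma sum_weight_containing:
  assumes i: "i \<in> {1..m}"
  shows "(\<Sum>J\<in>{J \<in> Pow {1..m}. i \<in> J}. weight m (card J)) = 1 - decay m"
proof -
  define r where "r = real m / real (m + 1)"
  have m: "0 < m" using i by auto
  define K where "K = {1..m} - {i}"
  have K: "finite K" "card K = m - 1" using i by (auto simp: K_def)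
  have "(\<Sum>J\<in>{J \<in> Pow {1..m}. i \<in> J}. weight m (card J)) = (\<Sum>J\<in>Pow K. weight m (Suc (card J)))"
  proof (rule sum.reindex_bij_witness[where i = "insert i" and j = "\<lambda>J. J - {i}"])
    fix J assume "J \<in> {J \<in> Pow {1..m}. i \<in> J}"
    then have "finite J" "i \<in> J" using finite_subset by auto
    then show "weight m (Suc (card (J - {i}))) = weight m (card J)"
      by (metis card_Suc_Diff1)
  qed (use i in \<open>auto simp: K_def\<close>)
  also have "\<dots> = (\<Sum>t\<le>m - 1. (m - 1 choose t) * weight m (Suc t))"
    using sum_Pow_card[OF K(1), of "\<lambda>t. weight m (Suc t)"] K(2) by simp
  also have "\<dots> = (\<Sum>t<m. r ^ (m - t) / m)"
  proof (rule sum.cong)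
    fix t assume "t \<in> {..<m}"
    then show "(m - 1 choose t) * weight m (Suc t) = r ^ (m - t) / m"
      using weight_Suc[of t m] by (simp add: r_def)
  qed (use m in auto)
  also have "\<dots> = (\<Sum>t<m. r * r ^ (m - Suc t)) / m"
    unfolding sum_divide_distrib
    by (intro sum.cong refl) (simp add: Suc_diff_Suc flip: power_Suc)
  also have "\<dots> = r * (\<Sum>t<m. r ^ t) / m"
    by (simp only: sum_distrib_left[symmetric] sum.nat_diff_reindex)
  also have "\<dots> = r / m * (\<Sum>t<m. r ^ t)" by simp
  also have "r / m = 1 / real (m + 1)" using m by (simp add: r_def)
  also have "\<dots> = 1 - r" by (simp add: r_def field_simps)
  also have "(1 - r) * (\<Sum>t<m. r ^ t) = 1 - decay m"
    unfolding decay_def r_def by (rule one_diff_power_eq[symmetric])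
  finally show ?thesis by simp
qed

lemma sum_if_mem:
  assumes "finite K" "J \<subseteq> K"
  shows "(\<Sum>i\<in>K. if i \<in> J then c else 0) = real (card J) * c"
  using sum.inter_restrict[OF assms(1), of "\<lambda>_. c" J] assms(2) by (simp add: Int_absorb1)

lemma sum_card_weight:
  "(\<Sum>J\<in>Pow {1..m}. real (card J) * weight m (card J)) = real m * (1 - decay m)"
proof -
  have "(\<Sum>J\<in>Pow {1..m}. real (card J) * weight m (card J))
      = (\<Sum>J\<in>Pow {1..m}. \<Sum>i\<in>{1..m}. if i \<in> J then weight m (card J) else 0)"
    by (intro sum.cong refl) (simp add: sum_if_mem)
  also have "\<dots> = (\<Sum>i\<in>{1..m}. \<Sum>J\<in>{J \<in> Pow {1..m}. i \<in> J}. weight m (card J))"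
    by (subst sum.swap) (simp only: sum.inter_filter finite_Pow_iff finite_atLeastAtMost)
  also have "\<dots> = (\<Sum>i\<in>{1..m}. 1 - decay m)"
    by (intro sum.cong refl sum_weight_containing)
  finally show ?thesis by simp
qed

section \<open>Labellings and mixtures over unions of parts\<close>

text \<open>Label 0 stands for elements outside the base, so one labelling encodes both a base, as
  \<open>part X \<sigma> {1..m}\<close>, and its partition.\<close>

definition part :: "'a set \<Rightarrow> ('a \<Rightarrow> nat) \<Rightarrow> nat set \<Rightarrow> 'a set" where
  "part X \<sigma> J = {x \<in> X. \<sigma> x \<in> J}"

definition mixture :: "nat \<Rightarrow> 'a set \<Rightarrow> ('a set \<Rightarrow> real) \<Rightarrow> ('a \<Rightarrow> nat) \<Rightarrow> real" where
  "mixture m X f \<sigma> = (\<Sum>J\<in>Pow {1..m}. weight m (card J) * f (part X \<sigma> J))"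

lemma mixture_diff: "mixture m X (\<lambda>S. f S - g S) \<sigma> = mixture m X f \<sigma> - mixture m X g \<sigma>"
  by (simp add: mixture_def algebra_simps sum_subtractf)

lemma mixture_modular:
  assumes fin: "finite X"
  shows "mixture m X (\<lambda>S. \<Sum>x\<in>S. l x) \<sigma> = (1 - decay m) * (\<Sum>x\<in>part X \<sigma> {1..m}. l x)"
proof -
  have "mixture m X (\<lambda>S. \<Sum>x\<in>S. l x) \<sigma>
      = (\<Sum>J\<in>Pow {1..m}. \<Sum>x\<in>part X \<sigma> {1..m}. if \<sigma> x \<in> J then weight m (card J) * l x else 0)"
    unfolding mixture_def sum_distrib_left
  proof (rule sum.cong[OF refl])
    fix J assume "J \<in> Pow {1..m}"
    then show "(\<Sum>x\<in>part X \<sigma> J. weight m (card J) * l x)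
        = (\<Sum>x\<in>part X \<sigma> {1..m}. if \<sigma> x \<in> J then weight m (card J) * l x else 0)"
      using fin by (intro sum.mono_neutral_cong_left) (auto simp: part_def)
  qed
  also have "\<dots> = (\<Sum>x\<in>part X \<sigma> {1..m}. l x * (\<Sum>J\<in>{J \<in> Pow {1..m}. \<sigma> x \<in> J}. weight m (card J)))"
    by (subst sum.swap, simp only: sum.inter_filter finite_Pow_iff finite_atLeastAtMost sum_distrib_left)
      (auto intro!: sum.cong)
  also have "\<dots> = (\<Sum>x\<in>part X \<sigma> {1..m}. l x * (1 - decay m))"
  proof (rule sum.cong[OF refl])
    fix x assume "x \<in> part X \<sigma> {1..m}"
    then have "\<sigma> x \<in> {1..m}" by (simp add: part_def)
    then show "l x * (\<Sum>J\<in>{J \<in> Pow {1..m}. \<sigma> x \<in> J}. weight m (card J)) = l x * (1 - decay m)"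
      by (simp only: sum_weight_containing)
  qed
  finally show ?thesis by (simp add: sum_distrib_left mult.commute)
qed

text \<open>The single removals within one part cost together at most the removal of the whole part.
  This trades elements for labels, so that only sets of the form \<open>part X \<sigma> K\<close>
  remain to be compared.\<close>

lemma sum_part_removals_le:
  assumes g: "submodular_on X g" and fin: "finite X" and J: "finite J" "0 \<notin> J"
  shows "(\<Sum>a\<in>part X \<sigma> J. g (part X \<sigma> J) - g (part X \<sigma> J - {a}))
    \<le> (\<Sum>i\<in>J. g (part X \<sigma> J) - g (part X \<sigma> (J - {i})))"
proof -
  let ?T = "part X \<sigma> J"
  have "(\<Sum>a\<in>?T. g ?T - g (?T - {a})) = (\<Sum>i\<in>J. \<Sum>a\<in>{a \<in> ?T. \<sigma> a = i}. g ?T - g (?T - {a}))"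
    using fin J by (intro sum.group[symmetric]) (auto simp: part_def)
  also have "\<dots> \<le> (\<Sum>i\<in>J. g ?T - g (part X \<sigma> (J - {i})))"
  proof (rule sum_mono)
    fix i assume "i \<in> J"
    have "(\<Sum>a\<in>{a \<in> ?T. \<sigma> a = i}. g ?T - g (?T - {a})) \<le> g ?T - g (?T - {a \<in> ?T. \<sigma> a = i})"
      using fin by (intro sum_removals_le[OF g]) (auto simp: part_def)
    moreover have "?T - {a \<in> ?T. \<sigma> a = i} = part X \<sigma> (J - {i})" by (auto simp: part_def)
    ultimately show "(\<Sum>a\<in>{a \<in> ?T. \<sigma> a = i}. g ?T - g (?T - {a})) \<le> g ?T - g (part X \<sigma> (J - {i}))"
      by simp
  qed
  finally show ?thesis .
qed

text \<open>Pairs of a set and one of its labels correspond to pairs of a set and a label missing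
  from it; a set \<open>K\<close> arises from \<open>m - card K\<close> larger ones.\<close>

lemma sum_removed_parts:
  fixes G :: "nat set \<Rightarrow> real"
  shows "(\<Sum>J\<in>Pow {1..m}. \<Sum>i\<in>J. weight m (card J) * G (J - {i}))
    = (\<Sum>J\<in>Pow {1..m}. real (m - card J) * weight m (card J + 1) * G J)"
proof -
  have "(\<Sum>J\<in>Pow {1..m}. \<Sum>i\<in>J. weight m (card J) * G (J - {i}))
      = (\<Sum>(J, i)\<in>Sigma (Pow {1..m}) (\<lambda>J. J). weight m (card J) * G (J - {i}))"
    by (rule sum.Sigma) (auto intro: finite_subset)
  also have "\<dots> = (\<Sum>(J, i)\<in>Sigma (Pow {1..m}) (\<lambda>J. {1..m} - J). weight m (card J + 1) * G J)"
  proof (rule sum.reindex_bij_witness[where i = "\<lambda>(J, i). (insert i J, i)"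
        and j = "\<lambda>(J, i). (J - {i}, i)"], goal_cases)
    case (5 p)
    then have "card (fst p) = card (fst p - {snd p}) + 1"
      using card_Suc_Diff1[of "fst p" "snd p"] finite_subset[of "fst p" "{1..m}"] by auto
    then show ?case by (auto split: prod.splits)
  qed auto
  also have "\<dots> = (\<Sum>J\<in>Pow {1..m}. \<Sum>i\<in>{1..m} - J. weight m (card J + 1) * G J)"
    by (rule sum.Sigma[symmetric]) auto
  also have "\<dots> = (\<Sum>J\<in>Pow {1..m}. real (m - card J) * weight m (card J + 1) * G J)"
  proof (rule sum.cong)
    fix J assume "J \<in> Pow {1..m}"
    then have "card ({1..m} - J) = m - card J"
      using card_Diff_subset[of J "{1..m}"] finite_subset[of J "{1..m}"] by auto
    then show "(\<Sum>i\<in>{1..m} - J. weight m (card J + 1) * G J)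
        = real (m - card J) * weight m (card J + 1) * G J"
      by simp
  qed simp
  finally show ?thesis .
qed

lemma part_swap:
  assumes "b = a \<or> \<sigma> b = 0" "0 \<notin> J" "b \<in> X"
  shows "part X (\<sigma>(a := 0, b := j)) J
    = (if j \<in> J then insert b (part X \<sigma> J - {a}) else part X \<sigma> J - {a})"
  using assms by (auto simp: part_def)

text \<open>For fixed \<open>J\<close>, the removal of \<open>a\<close> is felt under all
  \<open>m\<close> target labels, but \<open>\<pi> a\<close> enters only under the
  \<open>card J\<close> labels in \<open>J\<close>. When the resulting bounds are added with their
  weights, the recurrence cancels all sets of labels except the two extreme ones.\<close>

lemma mixture_swaps:
  assumes g: "submodular_on X g" "mono_on (Pow X) g" and fin: "finite X" and m: "0 < m"
    and A: "A = part X \<sigma> {1..m}" and B: "B \<subseteq> X" and \<pi>: "bij_betw \<pi> A B"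
    and new: "\<And>a. a \<in> A \<Longrightarrow> \<pi> a = a \<or> \<sigma> (\<pi> a) = 0"
  shows "real m * ((1 - decay m) * g B + decay m * g {} - g A)
    \<le> (\<Sum>a\<in>A. \<Sum>j\<in>{1..m}. mixture m X g (\<sigma>(a := 0, \<pi> a := j)) - mixture m X g \<sigma>)"
proof -
  let ?T = "part X \<sigma>"
  let ?T' = "\<lambda>a j. part X (\<sigma>(a := 0, \<pi> a := j))"
  have TX: "?T J \<subseteq> X" for J by (auto simp: part_def)
  have fA: "finite A" using fin A by (auto simp: part_def)
  have \<pi>B: "\<pi> a \<in> B" if "a \<in> A" for a using \<pi> that by (auto simp: bij_betw_def)
  have per_set: "real (card J) * (g B - g (?T J)) - real m * (\<Sum>i\<in>J. g (?T J) - g (?T (J - {i})))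
      \<le> (\<Sum>a\<in>A. \<Sum>j\<in>{1..m}. g (?T' a j J) - g (?T J))" if J: "J \<in> Pow {1..m}" for J
  proof -
    have fJ: "finite J" and J0: "0 \<notin> J" using J finite_subset by auto
    have TA: "?T J \<subseteq> A" using J A by (auto simp: part_def)
    have one: "(g (?T J - {a}) - g (?T J)) + (if j \<in> J then g (insert (\<pi> a) (?T J)) - g (?T J) else 0)
        \<le> g (?T' a j J) - g (?T J)" if a: "a \<in> A" for a j
    proof (cases "j \<in> J")
      case True
      have bX: "\<pi> a \<in> X" using \<pi>B a B by auto
      have T': "?T' a j J = insert (\<pi> a) (?T J - {a})"
        using part_swap[of "\<pi> a" a \<sigma> J X j] new[OF a] J0 bX True by auto
      \<comment> \<open>The insertion is charged to \<open>?T J\<close> with \<open>a\<close> still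
        present, so that it no longer depends on the removal: by submodularity, or by monotonicity
        if \<open>\<pi> a = a\<close>.\<close>
      have "g (insert (\<pi> a) (?T J)) + g (?T J - {a}) \<le> g (?T J) + g (insert (\<pi> a) (?T J - {a}))"
      proof (cases "\<pi> a = a")
        case eq: True
        have "g (?T J - {a}) \<le> g (?T J)" by (rule mono_onD[OF g(2)]) (use TX in auto)
        then show ?thesis unfolding eq using a by (auto simp: insert_absorb)
      next
        case False
        then have "\<pi> a \<notin> ?T J" using new[OF a] J0 by (auto simp: part_def)
        then have "?T J \<union> insert (\<pi> a) (?T J - {a}) = insert (\<pi> a) (?T J)"
          "?T J \<inter> insert (\<pi> a) (?T J - {a}) = ?T J - {a}" by auto
        then show ?thesis
          using submodularD[OF g(1), of "?T J" "insert (\<pi> a) (?T J - {a})"] TX[of J] bX by auto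
      qed
      then show ?thesis using True T' by simp
    next
      case False
      then show ?thesis
        using part_swap[of "\<pi> a" a \<sigma> J X j] new[OF a] J0 \<pi>B[OF a] B by auto
    qed
    have cJ: "(\<Sum>j\<in>{1..m}. if j \<in> J then c else 0) = real (card J) * c" for c :: real
      using J by (simp add: sum_if_mem)
    have "(\<Sum>a\<in>A. real m * (g (?T J - {a}) - g (?T J)) + real (card J) * (g (insert (\<pi> a) (?T J)) - g (?T J)))
        \<le> (\<Sum>a\<in>A. \<Sum>j\<in>{1..m}. g (?T' a j J) - g (?T J))"
    proof (rule sum_mono)
      fix a assume a: "a \<in> A"
      have "(\<Sum>j\<in>{1..m}. (g (?T J - {a}) - g (?T J)) + (if j \<in> J then g (insert (\<pi> a) (?T J)) - g (?T J) else 0))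
          \<le> (\<Sum>j\<in>{1..m}. g (?T' a j J) - g (?T J))"
        by (intro sum_mono one a)
      then show "real m * (g (?T J - {a}) - g (?T J)) + real (card J) * (g (insert (\<pi> a) (?T J)) - g (?T J))
          \<le> (\<Sum>j\<in>{1..m}. g (?T' a j J) - g (?T J))"
        by (simp only: sum.distrib cJ) simp
    qed
    moreover have "(\<Sum>a\<in>A. g (?T J) - g (?T J - {a})) = (\<Sum>a\<in>?T J. g (?T J) - g (?T J - {a}))"
      using fA TA by (intro sum.mono_neutral_right) auto
    moreover have "(\<Sum>a\<in>?T J. g (?T J) - g (?T J - {a})) \<le> (\<Sum>i\<in>J. g (?T J) - g (?T (J - {i})))"
      by (rule sum_part_removals_le[OF g(1) fin fJ J0])
    moreover have "(\<Sum>a\<in>A. g (insert (\<pi> a) (?T J)) - g (?T J)) = (\<Sum>b\<in>B. g (insert b (?T J)) - g (?T J))"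
      using \<pi> by (rule sum.reindex_bij_betw)
    moreover have "g B - g (?T J) \<le> (\<Sum>b\<in>B. g (insert b (?T J)) - g (?T J))"
    proof -
      have "g B \<le> g (?T J \<union> B)" by (rule mono_onD[OF g(2)]) (use TX B in auto)
      also have "g (?T J \<union> B) - g (?T J) \<le> (\<Sum>b\<in>B. g (insert b (?T J)) - g (?T J))"
        using B fin finite_subset TX by (intro sum_additions_ge[OF g(1)]) auto
      finally show ?thesis by simp
    qed
    moreover have "(\<Sum>a\<in>A. real m * (g (?T J - {a}) - g (?T J)) + real (card J) * (g (insert (\<pi> a) (?T J)) - g (?T J)))
        = real (card J) * (\<Sum>a\<in>A. g (insert (\<pi> a) (?T J)) - g (?T J))
          - real m * (\<Sum>a\<in>A. g (?T J) - g (?T J - {a}))"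
      by (simp add: sum.distrib sum_distrib_left sum_subtractf algebra_simps)
    ultimately show ?thesis
      by (smt (verit, ccfv_SIG) mult_left_mono of_nat_0_le_iff)
  qed
  define w where "w = (\<lambda>J :: nat set. weight m (card J))"
  \<comment> \<open>\<open>c J\<close> collects what multiplies \<open>g (?T J)\<close>: a positive
    share from the sets with one label more, a negative one from \<open>J\<close> itself.\<close>
  define c where "c = (\<lambda>J :: nat set. real m * real (m - card J) * weight m (card J + 1)
      - real (m + 1) * real (card J) * weight m (card J))"
  have c0: "c J = 0" if "J \<in> Pow {1..m}" "J \<noteq> {}" "J \<noteq> {1..m}" for J
  proof -
    have "finite J" using that finite_subset by auto
    then have "0 < card J" using that by (simp add: card_gt_0_iff)
    moreover have "card J < m" using that psubset_card_mono[of "{1..m}" J] by auto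
    ultimately show ?thesis using weight_recurrence[of "card J" m] by (simp add: c_def mult_ac)
  qed
  \<comment> \<open>Up to the factor \<open>m\<close>, the two survivors yield the terms
    \<open>decay m * g {}\<close> and \<open>- g A\<close> of the claim.\<close>
  have cs: "c {} = real m * decay m" "c {1..m} = - real m"
    using weight_first[OF m] weight_last[OF m] m by (auto simp: c_def)
  have "(\<Sum>J\<in>Pow {1..m}. c J * g (?T J)) = (\<Sum>J\<in>{{}, {1..m}}. c J * g (?T J))"
    using c0 by (intro sum.mono_neutral_right) auto
  also have "\<dots> = real m * (decay m * g {} - g A)"
  proof -
    have "?T {} = {}" "?T {1..m} = A" using A by (auto simp: part_def)
    moreover have "{} \<noteq> {1..m}" using m by auto
    ultimately show ?thesis by (simp add: cs[simplified] algebra_simps)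
  qed
  finally have sc: "(\<Sum>J\<in>Pow {1..m}. c J * g (?T J)) = real m * (decay m * g {} - g A)" .
  have "(\<Sum>J\<in>Pow {1..m}. w J * (real (card J) * (g B - g (?T J))
        - real m * (\<Sum>i\<in>J. g (?T J) - g (?T (J - {i})))))
      = (\<Sum>J\<in>Pow {1..m}. real (card J) * w J) * g B
        - (\<Sum>J\<in>Pow {1..m}. real (m + 1) * real (card J) * w J * g (?T J))
        + real m * (\<Sum>J\<in>Pow {1..m}. \<Sum>i\<in>J. w J * g (?T (J - {i})))"
    by (simp add: sum_distrib_left sum_distrib_right sum_subtractf sum.distrib algebra_simps)
  also have "\<dots> = real m * (1 - decay m) * g B + (\<Sum>J\<in>Pow {1..m}. c J * g (?T J))"
    unfolding w_def sum_card_weight sum_removed_parts[of m "\<lambda>K. g (?T K)"] c_def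
    by (simp add: sum_distrib_left sum_subtractf sum.distrib algebra_simps)
  also have "\<dots> = real m * ((1 - decay m) * g B + decay m * g {} - g A)"
    unfolding sc by (simp add: algebra_simps)
  finally have "real m * ((1 - decay m) * g B + decay m * g {} - g A)
      = (\<Sum>J\<in>Pow {1..m}. w J * (real (card J) * (g B - g (?T J))
        - real m * (\<Sum>i\<in>J. g (?T J) - g (?T (J - {i})))))" by simp
  also have "\<dots> \<le> (\<Sum>J\<in>Pow {1..m}. w J * (\<Sum>a\<in>A. \<Sum>j\<in>{1..m}. g (?T' a j J) - g (?T J)))"
    by (intro sum_mono mult_left_mono per_set) (auto simp: w_def weight_nonneg)
  also have "\<dots> = (\<Sum>a\<in>A. \<Sum>j\<in>{1..m}. \<Sum>J\<in>Pow {1..m}. w J * (g (?T' a j J) - g (?T J)))"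
    unfolding sum_distrib_left
    by (subst sum.swap, intro sum.cong refl, subst sum.swap, rule refl)
  also have "\<dots> = (\<Sum>a\<in>A. \<Sum>j\<in>{1..m}. mixture m X g (\<sigma>(a := 0, \<pi> a := j)) - mixture m X g \<sigma>)"
    by (simp add: mixture_def w_def right_diff_distrib sum_subtractf)
  finally show ?thesis .
qed

section \<open>Swaps of labelled bases and their gain in potential\<close>

definition labelled_base :: "nat \<Rightarrow> 'a set \<Rightarrow> 'a set set \<Rightarrow> ('a \<Rightarrow> nat) \<Rightarrow> bool" where
  "labelled_base m X \<I> \<sigma> \<longleftrightarrow> (\<forall>x\<in>X. \<sigma> x \<le> m) \<and> part X \<sigma> {1..m} \<in> \<I> \<and>
     card (part X \<sigma> {1..m}) = matroid_rank \<I>"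

text \<open>With \<open>b = a\<close> a swap only moves \<open>a\<close> to another part, which the
  fixed points of the exchange bijection require; the update to \<open>j\<close> comes last and
  overrides the 0.\<close>

definition swap_ok :: "nat \<Rightarrow> 'a set \<Rightarrow> 'a set set \<Rightarrow> ('a \<Rightarrow> nat) \<Rightarrow> 'a \<Rightarrow> 'a \<Rightarrow> nat \<Rightarrow> bool" where
  "swap_ok m X \<I> \<sigma> a b j \<longleftrightarrow> a \<in> X \<and> b \<in> X \<and> j \<in> {1..m} \<and> \<sigma> a \<noteq> 0 \<and> (b = a \<or> \<sigma> b = 0) \<and>
     part X (\<sigma>(a := 0, b := j)) {1..m} \<in> \<I>"

text \<open>By \<open>mixture_modular\<close>, a modular \<open>l\<close> has mixture \<open>(1 - decay m) l(A)\<close>, so adding \<open>decay m\<close> times the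
  marginals to the mixture of \<open>f\<close> amounts to the full marginals plus the mixture of \<open>residual X f\<close>.\<close>

definition potential ::
  "nat \<Rightarrow> 'a set \<Rightarrow> ('a \<Rightarrow> 'a \<Rightarrow> real) \<Rightarrow> ('a set \<Rightarrow> real) \<Rightarrow> real \<Rightarrow> ('a \<Rightarrow> nat) \<Rightarrow> real" where
  "potential m X d f k \<sigma> = k / (k + 2) * dispersion d (part X \<sigma> {1..m})
     + decay m * (\<Sum>x\<in>part X \<sigma> {1..m}. marginal X f x) + mixture m X f \<sigma>"

lemma matroid_rank_ge: "matroid X \<I> \<Longrightarrow> S \<in> \<I> \<Longrightarrow> card S \<le> matroid_rank \<I>"
  unfolding matroid_rank_def matroid_def
  by (intro Max_ge finite_imageI) (auto intro: finite_subset)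

lemma matroid_rank_attained:
  assumes "matroid X \<I>"
  shows "\<exists>S\<in>\<I>. card S = matroid_rank \<I>"
proof -
  have "finite \<I>" "\<I> \<noteq> {}" using assms unfolding matroid_def by (auto intro: finite_subset)
  then have "Max (card ` \<I>) \<in> card ` \<I>" by (intro Max_in) auto
  then show ?thesis unfolding matroid_rank_def by auto
qed

lemma decay_bounds: "0 \<le> decay m" "decay m \<le> 1"
  unfolding decay_def by (auto intro!: power_le_one)

lemma part_mono: "J \<subseteq> K \<Longrightarrow> part X \<sigma> J \<subseteq> part X \<sigma> K"
  by (auto simp: part_def)

lemma labelled_base_swap:
  assumes fin: "finite X" and lb: "labelled_base m X \<I> \<sigma>" and sw: "swap_ok m X \<I> \<sigma> a b j"
  shows "labelled_base m X \<I> (\<sigma>(a := 0, b := j))"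
proof -
  let ?A = "part X \<sigma> {1..m}"
  have a: "a \<in> ?A" and b: "b \<notin> ?A - {a}"
    using lb sw by (auto simp: labelled_base_def swap_ok_def part_def)
  have "part X (\<sigma>(a := 0, b := j)) {1..m} = insert b (?A - {a})"
    using sw part_swap[of b a \<sigma> "{1..m}" X j] by (auto simp: swap_ok_def)
  moreover have "finite ?A" using fin by (simp add: part_def)
  then have "card (insert b (?A - {a})) = card ?A"
    using a b card_Suc_Diff1[of ?A a] by simp
  ultimately show ?thesis
    using lb sw unfolding labelled_base_def swap_ok_def by auto
qed

lemma dispersion_nonneg: "distance_on X d \<Longrightarrow> A \<subseteq> X \<Longrightarrow> 0 \<le> dispersion d A"
  unfolding dispersion_def distance_on_def by (auto intro!: sum_nonneg)

lemma dispersion_mono: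
  assumes "distance_on X d" "finite X" "A \<subseteq> B" "B \<subseteq> X"
  shows "dispersion d A \<le> dispersion d B"
proof -
  have "finite B" using assms finite_subset by auto
  have "(\<Sum>a\<in>A. \<Sum>b\<in>A. d a b) \<le> (\<Sum>a\<in>A. \<Sum>b\<in>B. d a b)"
    using assms \<open>finite B\<close> by (intro sum_mono sum_mono2) (auto simp: distance_on_def subset_iff)
  also have "\<dots> \<le> (\<Sum>a\<in>B. \<Sum>b\<in>B. d a b)"
    using assms \<open>finite B\<close> by (intro sum_mono2) (auto simp: distance_on_def subset_iff intro!: sum_nonneg)
  finally show ?thesis unfolding dispersion_def by simp
qed

text \<open>Since \<open>weight m 0\<close> is 0, every weight is at most \<open>card J\<close>
  times itself, and these multiples sum to m (1 - \<open>decay m\<close>). So the mixture is at most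
  m f(A), and the other two terms add at most d(A) + f(A).\<close>

lemma potential_bounds:
  assumes fin: "finite X" and d: "distance_on X d" and f0: "\<And>A. A \<subseteq> X \<Longrightarrow> 0 \<le> f A"
    and mono: "mono_on (Pow X) f" and sm: "submodular_on X f" and k: "0 \<le> k"
    and A: "A = part X \<sigma> {1..m}"
  shows "0 \<le> potential m X d f k \<sigma>"
    "potential m X d f k \<sigma> \<le> real (m + 1) * (dispersion d A + f A)"
proof -
  have AX: "A \<subseteq> X" using A by (auto simp: part_def)
  note dA = dispersion_nonneg[OF d AX]
  note q = decay_bounds[of m]
  have w: "0 \<le> k / (k + 2)" "k / (k + 2) \<le> 1" using k by auto
  have l0: "0 \<le> (\<Sum>x\<in>A. marginal X f x)"
    by (intro sum_nonneg marginal_nonneg[OF mono])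
  have "(\<Sum>x\<in>A. marginal X f x) \<le> f A - f (A - A)"
    by (rule sum_marginal_le[OF sm fin]) (use AX in auto)
  then have l1: "(\<Sum>x\<in>A. marginal X f x) \<le> f A" using f0[of "{}"] by simp
  have pX: "part X \<sigma> J \<subseteq> X" for J by (auto simp: part_def)
  have m0: "0 \<le> mixture m X f \<sigma>"
    unfolding mixture_def by (intro sum_nonneg mult_nonneg_nonneg weight_nonneg f0 pX)
  show "0 \<le> potential m X d f k \<sigma>"
    unfolding potential_def A[symmetric] using w(1) q(1) dA l0 m0 by (simp del: times_divide_eq_left)
  have "mixture m X f \<sigma> \<le> (\<Sum>J\<in>Pow {1..m}. real (card J) * weight m (card J) * f A)"
    unfolding mixture_def
  proof (rule sum_mono)
    fix J assume J: "J \<in> Pow {1..m}"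
    have "weight m (card J) * f (part X \<sigma> J) \<le> weight m (card J) * f A"
      unfolding A by (intro mult_left_mono weight_nonneg mono_onD[OF mono] part_mono) (use J pX in auto)
    also have "\<dots> \<le> real (card J) * weight m (card J) * f A"
    proof (intro mult_right_mono f0 AX)
      show "weight m (card J) \<le> real (card J) * weight m (card J)"
        using weight_nonneg[of m "card J"] mult_right_mono[of 1 "real (card J)" "weight m (card J)"]
        by (cases "card J = 0") (auto simp: weight_0)
    qed
    finally show "weight m (card J) * f (part X \<sigma> J) \<le> real (card J) * weight m (card J) * f A" .
  qed
  also have "\<dots> = real m * ((1 - decay m) * f A)"
    by (simp only: sum_distrib_right[symmetric] sum_card_weight)
  finally have m1: "mixture m X f \<sigma> \<le> real m * ((1 - decay m) * f A)" .
  have "(1 - decay m) * f A \<le> f A"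
    using q f0[OF AX] by (simp add: mult_left_le_one_le)
  then have "real m * ((1 - decay m) * f A) \<le> real m * f A" by (intro mult_left_mono) auto
  moreover have "k / (k + 2) * dispersion d A \<le> dispersion d A"
    using w dA by (intro mult_left_le_one_le) auto
  moreover have "decay m * (\<Sum>x\<in>A. marginal X f x) \<le> (\<Sum>x\<in>A. marginal X f x)"
    using q l0 by (intro mult_left_le_one_le) auto
  moreover have "0 \<le> real m * dispersion d A" using dA by simp
  ultimately show "potential m X d f k \<sigma> \<le> real (m + 1) * (dispersion d A + f A)"
    using l1 m1 unfolding potential_def A[symmetric] by (simp add: algebra_simps)
qed

text \<open>Averaging: the \<open>k * m\<close> swaps along the exchange bijection gain at least
  \<open>m * \<Delta>\<close> together, so one of them gains \<open>\<Delta> / k\<close>. Here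
  \<open>\<Delta>\<close> is the target minus the current objective.\<close>

lemma improving_swap:
  assumes M: "matroid X \<I>" and d: "distance_on X d" "negative_type_on X d"
    and mono: "mono_on (Pow X) f" and sm: "submodular_on X f" and m: "0 < m"
    and k: "k = real (matroid_rank \<I>)" "k > 0"
    and lb: "labelled_base m X \<I> \<sigma>" and A: "A = part X \<sigma> {1..m}"
    and B: "B \<in> \<I>" "card B = matroid_rank \<I>"
    and gap: "\<Delta> = (1 - 4 / (k + 2)) * dispersion d B + (1 - decay m) * f B
      + decay m * (\<Sum>x\<in>B. marginal X f x) + decay m * f {} - (dispersion d A + f A)"
  shows "\<exists>a b j. swap_ok m X \<I> \<sigma> a b j \<and>
    potential m X d f k \<sigma> + \<Delta> / k \<le> potential m X d f k (\<sigma>(a := 0, b := j))"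
proof -
  have fin: "finite X" and BX: "B \<subseteq> X" using M B unfolding matroid_def by auto
  have AX: "A \<subseteq> X" using A by (auto simp: part_def)
  have cA: "A \<in> \<I>" "card A = matroid_rank \<I>" using lb unfolding labelled_base_def A by auto
  obtain \<pi> where \<pi>: "bij_betw \<pi> A B" "\<And>a. a \<in> A \<Longrightarrow> insert (\<pi> a) (A - {a}) \<in> \<I>"
      "\<And>a. a \<in> A \<inter> B \<Longrightarrow> \<pi> a = a" "\<And>a. a \<in> A - B \<Longrightarrow> \<pi> a \<notin> A"
    using exchange_bijection[OF M cA(1) B(1)] cA(2) B(2) matroid_rank_ge[OF M] by auto
  have new: "\<pi> a = a \<or> \<pi> a \<notin> A" if "a \<in> A" for a
    using \<pi>(3,4)[of a] that by blast
  have \<pi>B: "\<pi> a \<in> B" if "a \<in> A" for a using \<pi>(1) that by (auto simp: bij_betw_def)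
  have new0: "\<pi> a = a \<or> \<sigma> (\<pi> a) = 0" if "a \<in> A" for a
    using new[OF that] \<pi>B[OF that] BX lb by (force simp: A part_def labelled_base_def)
  define \<tau> where "\<tau> = (\<lambda>a j. \<sigma>(a := 0, \<pi> a := j))"
  have \<tau>: "part X (\<tau> a j) {1..m} = insert (\<pi> a) (A - {a})" if "a \<in> A" "j \<in> {1..m}" for a j
    unfolding \<tau>_def A using that new0[OF that(1)] \<pi>B[OF that(1)] BX
    by (subst part_swap) auto
  have ok: "swap_ok m X \<I> \<sigma> a (\<pi> a) j" if "a \<in> A" "j \<in> {1..m}" for a j
    using \<tau>[OF that] \<pi>(2)[OF that(1)] new0[OF that(1)] \<pi>B[OF that(1)] BX that
    unfolding swap_ok_def \<tau>_def by (auto simp: A part_def)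
  define l where "l = (\<lambda>S. \<Sum>x\<in>S. marginal X f x)"
  define g where "g = residual X f"
  have g: "submodular_on X g" "mono_on (Pow X) g"
    unfolding g_def using residual_mono[OF sm fin] residual_submodular[OF sm fin] by auto
  have gl: "f S = l S + g S" for S by (simp add: g_def l_def residual_def)
  define w where "w = k / (k + 2)"
  have pot: "potential m X d f k \<rho> = w * dispersion d (part X \<rho> {1..m}) + l (part X \<rho> {1..m}) + mixture m X g \<rho>" for \<rho>
    unfolding potential_def g_def residual_def mixture_diff
    using mixture_modular[OF fin, of m "marginal X f" \<rho>]
    by (simp add: w_def l_def algebra_simps)
  have k': "k = real (card A)" using k cA by simp
  have D: "(1 - 4 / (k + 2)) * dispersion d B - dispersion d A
      \<le> w * (\<Sum>a\<in>A. dispersion d (insert (\<pi> a) (A - {a})) - dispersion d A)"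
    unfolding w_def by (rule sum_dispersion_swaps[OF fin d AX BX \<pi>(1) k' k(2) new])
  have fA: "finite A" using AX fin finite_subset by auto
  have L: "(\<Sum>a\<in>A. l (insert (\<pi> a) (A - {a})) - l A) = l B - l A"
  proof -
    have "l (insert (\<pi> a) (A - {a})) - l A = marginal X f (\<pi> a) - marginal X f a" if "a \<in> A" for a
      using new[OF that] fA that sum.remove[of A a "marginal X f"]
      by (auto simp: l_def insert_absorb)
    then have "(\<Sum>a\<in>A. l (insert (\<pi> a) (A - {a})) - l A) = (\<Sum>a\<in>A. marginal X f (\<pi> a)) - l A"
      by (simp add: sum_subtractf l_def)
    also have "(\<Sum>a\<in>A. marginal X f (\<pi> a)) = l B"
      unfolding l_def using \<pi>(1) by (rule sum.reindex_bij_betw)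
    finally show ?thesis .
  qed
  have G: "real m * ((1 - decay m) * g B + decay m * g {} - g A)
      \<le> (\<Sum>a\<in>A. \<Sum>j\<in>{1..m}. mixture m X g (\<tau> a j) - mixture m X g \<sigma>)"
    unfolding \<tau>_def by (rule mixture_swaps[OF g fin m A BX \<pi>(1) new0])
  have "(\<Sum>a\<in>A. \<Sum>j\<in>{1..m}. potential m X d f k (\<tau> a j) - potential m X d f k \<sigma>)
      = (\<Sum>a\<in>A. \<Sum>j\<in>{1..m}. w * (dispersion d (insert (\<pi> a) (A - {a})) - dispersion d A)
          + (l (insert (\<pi> a) (A - {a})) - l A) + (mixture m X g (\<tau> a j) - mixture m X g \<sigma>))"
    by (intro sum.cong refl, simp only: pot \<tau> A[symmetric]) (simp add: algebra_simps)
  also have "\<dots> = real m * (w * (\<Sum>a\<in>A. dispersion d (insert (\<pi> a) (A - {a})) - dispersion d A))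
      + real m * (\<Sum>a\<in>A. l (insert (\<pi> a) (A - {a})) - l A)
      + (\<Sum>a\<in>A. \<Sum>j\<in>{1..m}. mixture m X g (\<tau> a j) - mixture m X g \<sigma>)"
    by (simp only: sum.distrib sum_constant sum_distrib_left[symmetric]) (simp add: sum_distrib_left mult.left_commute)
  also have "\<dots> \<ge> real m * ((1 - 4 / (k + 2)) * dispersion d B - dispersion d A) + real m * (l B - l A)
      + real m * ((1 - decay m) * g B + decay m * g {} - g A)"
    unfolding L by (intro add_mono mult_left_mono D G order_refl) auto
  \<comment> \<open>With q for \<open>decay m\<close>, the sum l(B) + (1 - q) g(B) equals (1 - q)
    f(B) + q l(B), and g({}) equals f({}); this is the form in which \<open>gap\<close> states the
    target.\<close>
  finally have "real m * \<Delta> \<le> (\<Sum>a\<in>A. \<Sum>j\<in>{1..m}. potential m X d f k (\<tau> a j) - potential m X d f k \<sigma>)"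
    unfolding gap gl l_def[symmetric] by (simp add: algebra_simps l_def)
  moreover have "(\<Sum>a\<in>A. \<Sum>j\<in>{1..m}. potential m X d f k (\<tau> a j) - potential m X d f k \<sigma>) < real m * \<Delta>"
    if less: "\<And>a j. a \<in> A \<Longrightarrow> j \<in> {1..m} \<Longrightarrow> potential m X d f k (\<tau> a j) - potential m X d f k \<sigma> < \<Delta> / k"
  proof -
    have "(\<Sum>a\<in>A. \<Sum>j\<in>{1..m}. potential m X d f k (\<tau> a j) - potential m X d f k \<sigma>)
        < (\<Sum>a\<in>A. \<Sum>j\<in>{1..m}. \<Delta> / k)"
      using less fA k k' m by (intro sum_strict_mono) auto
    also have "\<dots> = real m * \<Delta>" using k k' by simp
    finally show ?thesis .
  qed
  ultimately obtain a j where "a \<in> A" "j \<in> {1..m}"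
      "\<Delta> / k \<le> potential m X d f k (\<tau> a j) - potential m X d f k \<sigma>"
    by (meson linorder_not_le)
  then show ?thesis using ok unfolding \<tau>_def by (intro exI[of _ a] exI[of _ "\<pi> a"] exI[of _ j]) auto
qed

section \<open>Program logic\<close>

lemma update_simps [simp]:
  "narr (nupdate a i v s) b = (if b = a then (narr s a)(i := v) else narr s b)"
  "rarr (nupdate a i v s) b = rarr s b"
  "narr (rupdate a i x s) b = narr s b"
  "rarr (rupdate a i x s) b = (if b = a then (rarr s a)(i := x) else rarr s b)"
  by (simp_all add: nupdate_def rupdate_def)

primrec nwrites :: "com \<Rightarrow> name set" where
  "nwrites Skip = {}"
| "nwrites (NAssign a i e) = {a}"
| "nwrites (RAssign a i e) = {}"
| "nwrites (Seq c1 c2) = nwrites c1 \<union> nwrites c2"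
| "nwrites (If b c1 c2) = nwrites c1 \<union> nwrites c2"
| "nwrites (While b c) = nwrites c"

primrec rwrites :: "com \<Rightarrow> name set" where
  "rwrites Skip = {}"
| "rwrites (NAssign a i e) = {}"
| "rwrites (RAssign a i e) = {a}"
| "rwrites (Seq c1 c2) = rwrites c1 \<union> rwrites c2"
| "rwrites (If b c1 c2) = rwrites c1 \<union> rwrites c2"
| "rwrites (While b c) = rwrites c"

definition frame :: "name set \<Rightarrow> name set \<Rightarrow> state \<Rightarrow> state \<Rightarrow> bool" where
  "frame M R s s' \<longleftrightarrow> (\<forall>a. a \<notin> M \<longrightarrow> narr s' a = narr s a) \<and> (\<forall>a. a \<notin> R \<longrightarrow> rarr s' a = rarr s a)"

lemma frameD:
  "frame M R s s' \<Longrightarrow> a \<notin> M \<Longrightarrow> narr s' a = narr s a"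
  "frame M R s s' \<Longrightarrow> a \<notin> R \<Longrightarrow> rarr s' a = rarr s a"
  by (auto simp: frame_def)

lemma frame_refl: "frame M R s s"
  by (simp add: frame_def)

lemma frame_trans: "frame M R s s' \<Longrightarrow> frame M R s' s'' \<Longrightarrow> frame M R s s''"
  by (simp add: frame_def)

lemma frame_mono: "frame M R s s' \<Longrightarrow> M \<subseteq> M' \<Longrightarrow> R \<subseteq> R' \<Longrightarrow> frame M' R' s s'"
  unfolding frame_def by blast

lemma exec_frame: "exec P c s t s' \<Longrightarrow> frame (nwrites c) (rwrites c) s s'"
  by (induction rule: exec.induct) (auto simp: frame_def)

text \<open>Total correctness with a time bound. The write frame is part of the judgement, so
  \<open>runs_Seq\<close> hands to the second command, besides the assertion, all that the first
  leaves untouched.\<close>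

definition runs :: "problem \<Rightarrow> com \<Rightarrow> state \<Rightarrow> nat \<Rightarrow> (state \<Rightarrow> bool) \<Rightarrow> bool" where
  "runs P c s T Q \<longleftrightarrow> (\<exists>t s'. exec P c s t s' \<and> t \<le> T \<and> frame (nwrites c) (rwrites c) s s' \<and> Q s')"

lemma runsI: "exec P c s t s' \<Longrightarrow> t \<le> T \<Longrightarrow> Q s' \<Longrightarrow> runs P c s T Q"
  unfolding runs_def using exec_frame by blast

lemma runs_weaken:
  assumes "runs P c s T Q" "T \<le> T'" "\<And>s'. frame (nwrites c) (rwrites c) s s' \<Longrightarrow> Q s' \<Longrightarrow> Q' s'"
  shows "runs P c s T' Q'"
  using assms unfolding runs_def by (meson order_trans)

lemma runs_Skip: "Q s \<Longrightarrow> 1 \<le> T \<Longrightarrow> runs P Skip s T Q"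
  by (rule runsI[OF exec.Skip]) auto

lemma runs_NAssign:
  "Q (nupdate a (nval P s i) (nval P s e) s) \<Longrightarrow> runs P (NAssign a i e) s 1 Q"
  by (rule runsI[OF exec.NAssign]) auto

lemma runs_RAssign:
  "Q (rupdate a (nval P s i) (rval P s e) s) \<Longrightarrow> runs P (RAssign a i e) s 1 Q"
  by (rule runsI[OF exec.RAssign]) auto

lemma runs_Seq:
  assumes "runs P c1 s T1 R"
    and "\<And>s'. frame (nwrites c1) (rwrites c1) s s' \<Longrightarrow> R s' \<Longrightarrow> runs P c2 s' T2 Q"
  shows "runs P (Seq c1 c2) s (T1 + T2) Q"
  using assms unfolding runs_def[of P c1] runs_def[of P c2]
  by (meson add_mono exec.Seq runsI)

lemma runs_Seq_NAssign:
  assumes "runs P c (nupdate a (nval P s i) (nval P s e) s) T Q"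
  shows "runs P (Seq (NAssign a i e) c) s (1 + T) Q"
  by (rule runs_Seq[where R = "\<lambda>s'. s' = nupdate a (nval P s i) (nval P s e) s"],
      rule runs_NAssign, rule refl) (simp add: assms)

lemma runs_Seq_RAssign:
  assumes "runs P c (rupdate a (nval P s i) (rval P s e) s) T Q"
  shows "runs P (Seq (RAssign a i e) c) s (1 + T) Q"
  by (rule runs_Seq[where R = "\<lambda>s'. s' = rupdate a (nval P s i) (rval P s e) s"],
      rule runs_RAssign, rule refl) (simp add: assms)

lemma runs_If:
  assumes "bval P s b \<Longrightarrow> runs P c1 s T Q" "\<not> bval P s b \<Longrightarrow> runs P c2 s T Q"
  shows "runs P (If b c1 c2) s (Suc T) Q"
  using assms unfolding runs_def[of P c1] runs_def[of P c2]
  by (cases "bval P s b") (meson Suc_le_mono exec.IfTrue exec.IfFalse runsI)+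

definition for_loop :: "name \<Rightarrow> nexp \<Rightarrow> com \<Rightarrow> com" where
  "for_loop i e c = Seq (NAssign i (NConst 0) (NConst 0))
     (While (NLess (NGet i (NConst 0)) e)
       (Seq c (NAssign i (NConst 0) (NAdd (NGet i (NConst 0)) (NConst 1)))))"

lemma for_loop_writes [simp]:
  "nwrites (for_loop i e c) = insert i (nwrites c)" "rwrites (for_loop i e c) = rwrites c"
  by (auto simp: for_loop_def)

text \<open>Each round costs the body, the increment and the test; the final 2 is the initial
  assignment and the failing test. As \<open>counter\<close> makes \<open>I\<close> blind to the
  loop variable, its value reaches the body as a separate assumption.\<close>

lemma runs_for_loop:
  assumes e: "\<And>s. nval P s e = N" and i: "i \<notin> nwrites c"
    and I0: "I 0 s"
    and counter: "\<And>x v s. I x s \<Longrightarrow> I x (nupdate i 0 v s)"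
    and body: "\<And>x s'. x < N \<Longrightarrow> frame (insert i (nwrites c)) (rwrites c) s s' \<Longrightarrow> narr s' i 0 = x \<Longrightarrow>
      I x s' \<Longrightarrow> runs P c s' T (I (Suc x))"
  shows "runs P (for_loop i e c) s (N * (T + 2) + 2) (I N)"
proof -
  define F where "F = frame (insert i (nwrites c)) (rwrites c)"
  define W where "W = While (NLess (NGet i (NConst 0)) e)
       (Seq c (NAssign i (NConst 0) (NAdd (NGet i (NConst 0)) (NConst 1))))"
  have loop: "\<exists>t s2. exec P W s' t s2 \<and> t \<le> (N - x) * (T + 2) + 1 \<and> I N s2"
    if "x \<le> N" "F s s'" "narr s' i 0 = x" "I x s'" for x s'
    using that
  proof (induction "N - x" arbitrary: x s')
    case 0
    then have "exec P W s' 1 s'" unfolding W_def by (intro exec.WhileFalse) (simp add: e)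
    then show ?case using 0 by force
  next
    case (Suc n)
    then have xN: "x < N" by simp
    then obtain t s1 where s1: "exec P c s' t s1" "t \<le> T" "frame (nwrites c) (rwrites c) s' s1" "I (Suc x) s1"
      using body[of x s'] Suc.prems unfolding runs_def F_def by auto
    define s2 where "s2 = nupdate i 0 (Suc x) s1"
    have "narr s1 i 0 = x" using frameD(1)[OF s1(3) i] Suc.prems(3) by simp
    then have "exec P (NAssign i (NConst 0) (NAdd (NGet i (NConst 0)) (NConst 1))) s1 1 s2"
      using exec.NAssign[of P i "NConst 0" "NAdd (NGet i (NConst 0)) (NConst 1)" s1] by (simp add: s2_def)
    then have step: "exec P (Seq c (NAssign i (NConst 0) (NAdd (NGet i (NConst 0)) (NConst 1)))) s' (t + 1) s2"
      using s1(1) by (rule exec.Seq[rotated])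
    have "F s' s1" using s1(3) unfolding F_def by (rule frame_mono) auto
    then have "F s s1" using frame_trans Suc.prems(2) unfolding F_def by blast
    then have "F s s2" unfolding F_def frame_def s2_def by auto
    moreover have "I (Suc x) s2" unfolding s2_def by (rule counter[OF s1(4)])
    moreover have "narr s2 i 0 = Suc x" by (simp add: s2_def)
    moreover have n: "n = N - Suc x" using Suc.hyps(2) by simp
    ultimately obtain u s3 where s3: "exec P W s2 u s3" "u \<le> (N - Suc x) * (T + 2) + 1" "I N s3"
      using Suc.hyps(1)[of "Suc x" s2, OF n] xN by (meson Suc_leI)
    have "exec P W s' (Suc ((t + 1) + u)) s3"
      unfolding W_def by (rule exec.WhileTrue) (use step s3(1) xN Suc.prems(3) in \<open>auto simp: W_def e\<close>)
    moreover have "N - x = Suc (N - Suc x)" using xN by simp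
    then have "Suc ((t + 1) + u) \<le> (N - x) * (T + 2) + 1" using s3(2) s1(2) by simp
    ultimately show ?case using s3(3) by blast
  qed
  define s0 where "s0 = nupdate i 0 0 s"
  have "F s s0" unfolding F_def frame_def s0_def by simp
  moreover have "I 0 s0" unfolding s0_def by (rule counter[OF I0])
  ultimately obtain t s2 where s2: "exec P W s0 t s2" "t \<le> N * (T + 2) + 1" "I N s2"
    using loop[of 0 s0] by (auto simp: s0_def)
  have "exec P (NAssign i (NConst 0) (NConst 0)) s 1 s0"
    using exec.NAssign[of P i "NConst 0" "NConst 0" s] by (simp add: s0_def)
  then have "exec P (for_loop i e c) s (1 + t) s2"
    unfolding for_loop_def W_def[symmetric] using s2(1) by (rule exec.Seq)
  then show ?thesis by (rule runsI) (use s2 in auto)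
qed

primrec seqs :: "com list \<Rightarrow> com" where
  "seqs [] = Skip"
| "seqs (c # cs) = Seq c (seqs cs)"

lemma seqs_writes [simp]:
  "nwrites (seqs cs) = (\<Union>c\<in>set cs. nwrites c)" "rwrites (seqs cs) = (\<Union>c\<in>set cs. rwrites c)"
  by (induction cs) auto

lemma runs_seqs:
  assumes "I [] s" and "\<And>xs x ys s'. zs = xs @ x # ys \<Longrightarrow>
      frame (\<Union>z\<in>set zs. nwrites (h z)) (\<Union>z\<in>set zs. rwrites (h z)) s s' \<Longrightarrow>
      I xs s' \<Longrightarrow> runs P (h x) s' T (I (xs @ [x]))"
  shows "runs P (seqs (map h zs)) s (length zs * T + 1) (I zs)"
proof -
  define F where "F = frame (\<Union>z\<in>set zs. nwrites (h z)) (\<Union>z\<in>set zs. rwrites (h z))"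
  have "runs P (seqs (map h ys)) s' (length ys * T + 1) (I zs)"
    if "zs = xs @ ys" "F s s'" "I xs s'" for xs ys s'
    using that
  proof (induction ys arbitrary: xs s')
    case Nil
    then show ?case by (simp add: runs_Skip)
  next
    case (Cons y ys)
    have "runs P (Seq (h y) (seqs (map h ys))) s' (T + (length ys * T + 1)) (I zs)"
    proof (rule runs_Seq)
      show "runs P (h y) s' T (I (xs @ [y]))"
        using assms(2)[OF Cons.prems(1)] Cons.prems unfolding F_def by blast
      fix s1 assume fr: "frame (nwrites (h y)) (rwrites (h y)) s' s1" and I1: "I (xs @ [y]) s1"
      have "F s' s1" unfolding F_def using fr Cons.prems(1) by (auto elim!: frame_mono)
      then have "F s s1" using Cons.prems(2) frame_trans unfolding F_def by blast
      then show "runs P (seqs (map h ys)) s1 (length ys * T + 1) (I zs)"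
        using Cons.IH[of "xs @ [y]" s1] Cons.prems(1) I1 by simp
    qed
    then show ?case by (simp add: algebra_simps)
  qed
  from this[of "[]" zs s] show ?thesis using assms(1) by (simp add: F_def frame_refl)
qed

section \<open>Polynomial running times\<close>

definition polynomial :: "(nat \<Rightarrow> nat) \<Rightarrow> bool" where
  "polynomial T \<longleftrightarrow> (\<exists>p :: nat poly. \<forall>n. T n = poly p n)"

lemma polynomial_const: "polynomial (\<lambda>n. c)"
  unfolding polynomial_def by (rule exI[of _ "[:c:]"]) simp

lemma polynomial_id: "polynomial (\<lambda>n. n)"
  unfolding polynomial_def by (rule exI[of _ "[:0, 1:]"]) simp

lemma polynomial_add: "polynomial S \<Longrightarrow> polynomial T \<Longrightarrow> polynomial (\<lambda>n. S n + T n)"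
  unfolding polynomial_def by (metis poly_add)

lemma polynomial_mult: "polynomial S \<Longrightarrow> polynomial T \<Longrightarrow> polynomial (\<lambda>n. S n * T n)"
  unfolding polynomial_def by (metis poly_mult)

lemma polynomial_Suc: "polynomial T \<Longrightarrow> polynomial (\<lambda>n. Suc (T n))"
  using polynomial_add[OF polynomial_const[of 1], of T] by simp

lemmas polynomial_intros =
  polynomial_const polynomial_id polynomial_add polynomial_mult polynomial_Suc

section \<open>The program\<close>

text \<open>Arrays of natural numbers: \<open>0\<close> best labelling so far (the output), \<open>1\<close> current labelling,
  \<open>2\<close> candidate labelling, \<open>3\<close> best neighbour of the current labelling, \<open>4\<close> query set,
  \<open>5\<close> rank, \<open>6\<close> to \<open>11\<close> loop counters.  Arrays of reals: \<open>0\<close> accumulator, \<open>1\<close> marginals,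
  \<open>2\<close> potential of the best neighbour, \<open>3\<close> value of the output.  Label \<open>0\<close> means that an element is
  not in the set.\<close>

abbreviation cell :: "name \<Rightarrow> nexp" where
  "cell a \<equiv> NGet a (NConst 0)"

abbreviation rcell :: "name \<Rightarrow> rexp" where
  "rcell a \<equiv> RGet a (NConst 0)"

definition labels :: "problem \<Rightarrow> state \<Rightarrow> name \<Rightarrow> nat \<Rightarrow> nat" where
  "labels P s a = (\<lambda>i. if i < ground_size P then narr s a i else 0)"

lemma labels_cong: "narr s' a = narr s b \<Longrightarrow> labels P s' a = labels P s b"
  by (simp add: labels_def cong: if_cong)

lemma labels_nupdate:
  "i < ground_size P \<Longrightarrow> labels P (nupdate a i v s) a = (labels P s a)(i := v)"
  by (auto simp: labels_def)

lemma array_set_labels: "array_set P s a = {i. i < ground_size P \<and> labels P s a i \<noteq> 0}"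
  by (auto simp: array_set_def labels_def)

text \<open>Expressions have no conditionals, so truncated subtraction has to provide 0/1
  flags.\<close>

definition nonzero :: "nexp \<Rightarrow> nexp" where
  "nonzero e = NSub (NConst 1) (NSub (NConst 1) e)"

lemma nval_nonzero [simp]: "nval P s (nonzero e) = of_bool (nval P s e \<noteq> 0)"
  by (simp add: nonzero_def)

text \<open>The two truncated differences add up to the distance between \<open>e\<close> and
  \<open>j\<close>, so each summand flags equality. Only zero versus nonzero matters in the
  end.\<close>

primrec member :: "nat list \<Rightarrow> nexp \<Rightarrow> nexp" where
  "member [] e = NConst 0"
| "member (j # js) e = NAdd (NSub (NConst 1) (NAdd (NSub e (NConst j)) (NSub (NConst j) e))) (member js e)"

lemma nval_member: "nval P s (member js e) \<noteq> 0 \<longleftrightarrow> nval P s e \<in> set js"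
  by (induction js) auto

primrec nmult :: "nat \<Rightarrow> nexp \<Rightarrow> nexp" where
  "nmult 0 e = NConst 0"
| "nmult (Suc c) e = NAdd e (nmult c e)"

lemma nval_nmult [simp]: "nval P s (nmult c e) = c * nval P s e"
  by (induction c) auto

abbreviation ratio :: "nat \<Rightarrow> nat \<Rightarrow> rexp" where
  "ratio p q \<equiv> RDiv (RNat (NConst p)) (RNat (NConst q))"

abbreviation add_to_acc :: "rexp \<Rightarrow> com" where
  "add_to_acc x \<equiv> RAssign 0 (NConst 0) (RAdd (rcell 0) x)"

definition copy :: "name \<Rightarrow> name \<Rightarrow> com" where
  "copy dst src = for_loop 6 NGroundSize (NAssign dst (cell 6) (NGet src (cell 6)))"

text \<open>Running times are written in the shape that the rules for \<open>runs\<close> produce,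
  here that of \<open>runs_for_loop\<close>, so that the rules apply without arithmetic.\<close>

definition copy_time :: "nat \<Rightarrow> nat" where
  "copy_time n = n * (1 + 2) + 2"

lemma copy_writes [simp]: "nwrites (copy dst src) = {6, dst}" "rwrites (copy dst src) = {}"
  by (simp_all add: copy_def)

lemma runs_copy:
  assumes "dst \<noteq> src" "dst \<noteq> 6" "src \<noteq> 6"
  shows "runs P (copy dst src) s (copy_time (ground_size P)) (\<lambda>s'. labels P s' dst = labels P s src)"
proof -
  have "runs P (copy dst src) s (copy_time (ground_size P))
      (\<lambda>s'. \<forall>i<ground_size P. narr s' dst i = narr s src i)"
    unfolding copy_def copy_time_def
  proof (rule runs_for_loop[where I = "\<lambda>x s'. \<forall>i<x. narr s' dst i = narr s src i"])
    fix x s' assume "frame (insert 6 (nwrites (NAssign dst (cell 6) (NGet src (cell 6)))))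
        (rwrites (NAssign dst (cell 6) (NGet src (cell 6)))) s s'"
    then have "narr s' src = narr s src" using assms by (auto simp: frame_def)
    moreover assume "narr s' 6 0 = x" "\<forall>i<x. narr s' dst i = narr s src i"
    ultimately show "runs P (NAssign dst (cell 6) (NGet src (cell 6))) s' 1
        (\<lambda>s'. \<forall>i<Suc x. narr s' dst i = narr s src i)"
      by (intro runs_NAssign) (auto simp: less_Suc_eq)
  qed (use assms in auto)
  then show ?thesis by (rule runs_weaken) (auto simp: labels_def)
qed

text \<open>Potential and objective share one shape: a multiple of the dispersion, a multiple of a
  linear term and weighted oracle values. Fixed real coefficients are passed as pairs of naturals,
  the only constants a program has.\<close>

definition evaluate :: "name \<Rightarrow> rexp \<Rightarrow> nat \<times> nat \<Rightarrow> (nat list \<times> nat \<times> nat) list \<Rightarrow> com" where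
  "evaluate a w r cs =
     Seq (RAssign 0 (NConst 0) (RNat (NConst 0)))
    (Seq (for_loop 6 NGroundSize (for_loop 7 NGroundSize
           (add_to_acc (RMul w (RDiv (RMul (RNat (nonzero (NGet a (cell 6))))
             (RMul (RNat (nonzero (NGet a (cell 7)))) (RDist (cell 6) (cell 7)))) (RNat (NConst 2)))))))
    (Seq (for_loop 6 NGroundSize
           (add_to_acc (RMul (ratio (fst r) (snd r)) (RMul (RNat (nonzero (NGet a (cell 6)))) (RGet 1 (cell 6))))))
         (seqs (map (\<lambda>(J, p, q).
           Seq (for_loop 6 NGroundSize (NAssign 4 (cell 6) (member J (NGet a (cell 6)))))
               (add_to_acc (RMul (ratio p q) (RValue 4)))) cs))))"

definition evaluate_time :: "nat \<Rightarrow> nat \<Rightarrow> nat" where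
  "evaluate_time l n = 1 + ((n * ((n * (1 + 2) + 2) + 2) + 2) + ((n * (1 + 2) + 2) +
     (l * ((n * (1 + 2) + 2) + 1) + 1)))"

lemma runs_evaluate:
  assumes a: "a \<notin> {4, 6, 7}"
    and w: "\<And>s'. narr s' 5 = narr s 5 \<Longrightarrow> rval P s' w = wv"
  shows "runs P (evaluate a w r cs) s (evaluate_time (length cs) (ground_size P))
    (\<lambda>s'. rarr s' 0 0 = wv * dispersion (dist_entry P) (array_set P s a)
      + real (fst r) / real (snd r) * (\<Sum>i\<in>array_set P s a. rarr s 1 i)
      + (\<Sum>(J, p, q)\<leftarrow>cs. real p / real q * value_of P {i. i < ground_size P \<and> narr s a i \<in> set J}))"
proof -
  let ?n = "ground_size P"
  define A where "A = array_set P s a"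
  define b where "b = (\<lambda>i. of_bool (narr s a i \<noteq> 0) :: real)"
  define D where "D = (\<lambda>i j. wv * (b i * (b j * dist_entry P i j) / 2))"
  \<comment> \<open>\<open>ok\<close> lists what later stages still read: the labelling, the rank
    array on which \<open>w\<close> may depend, and the stored marginals.\<close>
  define ok where "ok = (\<lambda>s' :: state. narr s' a = narr s a \<and> narr s' 5 = narr s 5 \<and> rarr s' 1 = rarr s 1)"
  have ok_frame: "ok s''" if "ok s'" "frame M R s' s''" "M \<subseteq> {4, 6, 7}" "1 \<notin> R" for s' s'' M R
  proof -
    have "a \<notin> M" "5 \<notin> M" using a that(3) by auto
    then show ?thesis
      using that(1) frameD(1)[OF that(2)] frameD(2)[OF that(2) that(4)] by (simp add: ok_def)
  qed
  have ok_upd: "ok (nupdate i j v s') = ok s'" if "i \<in> {4, 6, 7}" for i j v s'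
    using that a unfolding ok_def by auto
  have restrict: "(\<Sum>i<?n. b i * h i) = (\<Sum>i\<in>A. h i)" for h
    unfolding A_def by (rule sum.mono_neutral_cong_right) (auto simp: array_set_def b_def)
  show ?thesis
    unfolding evaluate_def evaluate_time_def
  proof (rule runs_Seq[where R = "\<lambda>s'. ok s' \<and> rarr s' 0 0 = 0"],
      goal_cases init rest)
    case init
    show ?case by (rule runs_RAssign) (auto simp: ok_def)
  next
    case (rest s1)
    show ?case
    proof (rule runs_Seq[where R = "\<lambda>s'. ok s' \<and> rarr s' 0 0 = wv * dispersion (dist_entry P) A"],
        goal_cases disp rest)
      case disp
      have "runs P (for_loop 6 NGroundSize (for_loop 7 NGroundSize
          (add_to_acc (RMul w (RDiv (RMul (RNat (nonzero (NGet a (cell 6))))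
            (RMul (RNat (nonzero (NGet a (cell 7)))) (RDist (cell 6) (cell 7)))) (RNat (NConst 2)))))))
          s1 (?n * ((?n * (1 + 2) + 2) + 2) + 2) (\<lambda>s'. ok s' \<and> rarr s' 0 0 = (\<Sum>i<?n. \<Sum>j<?n. D i j))"
      proof (rule runs_for_loop[where I = "\<lambda>x s'. ok s' \<and> rarr s' 0 0 = (\<Sum>i<x. \<Sum>j<?n. D i j)"],
          goal_cases e i init upd body)
        case (body x s2)
        have "runs P (for_loop 7 NGroundSize
          (add_to_acc (RMul w (RDiv (RMul (RNat (nonzero (NGet a (cell 6))))
            (RMul (RNat (nonzero (NGet a (cell 7)))) (RDist (cell 6) (cell 7)))) (RNat (NConst 2))))))
          s2 (?n * (1 + 2) + 2) (\<lambda>s'. ok s' \<and> rarr s' 0 0 = (\<Sum>i<x. \<Sum>j<?n. D i j) + (\<Sum>j<?n. D x j))"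
        proof (rule runs_for_loop[where I =
              "\<lambda>y s'. ok s' \<and> rarr s' 0 0 = (\<Sum>i<x. \<Sum>j<?n. D i j) + (\<Sum>j<y. D x j)"],
            goal_cases e i init upd body)
          case (body y s3)
          have "narr s3 6 0 = x" using body(2) \<open>narr s2 6 0 = x\<close> by (auto simp: frame_def)
          moreover have "rval P s3 w = wv" using body(4) w by (auto simp: ok_def)
          ultimately show ?case
            using body \<open>x < ?n\<close> by (intro runs_RAssign) (auto simp: ok_def D_def b_def)
        qed (use \<open>ok s2 \<and> _\<close> in \<open>auto simp: ok_upd\<close>)
        then show ?case by (rule runs_weaken) auto
      qed (use rest in \<open>auto simp: ok_upd\<close>)
      moreover have "(\<Sum>i<?n. \<Sum>j<?n. D i j) = wv * dispersion (dist_entry P) A"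
      proof -
        have "(\<Sum>j<?n. D i j) = b i * (wv / 2 * (\<Sum>j\<in>A. dist_entry P i j))" for i
          unfolding restrict[symmetric] D_def by (simp add: sum_distrib_left mult_ac)
        then have "(\<Sum>i<?n. \<Sum>j<?n. D i j) = (\<Sum>i\<in>A. wv / 2 * (\<Sum>j\<in>A. dist_entry P i j))"
          by (simp only: restrict)
        then show ?thesis by (simp add: dispersion_def sum_distrib_left sum_divide_distrib)
      qed
      ultimately show ?case by simp
    next
      case (rest s2)
      show ?case
      proof (rule runs_Seq[where R = "\<lambda>s'. ok s' \<and> rarr s' 0 0 = wv * dispersion (dist_entry P) A
            + real (fst r) / real (snd r) * (\<Sum>i\<in>A. rarr s 1 i)"], goal_cases lin rest)
        case lin
        have "runs P (for_loop 6 NGroundSize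
           (add_to_acc (RMul (ratio (fst r) (snd r)) (RMul (RNat (nonzero (NGet a (cell 6)))) (RGet 1 (cell 6))))))
           s2 (?n * (1 + 2) + 2) (\<lambda>s'. ok s' \<and> rarr s' 0 0 = wv * dispersion (dist_entry P) A
            + (\<Sum>i<?n. b i * (real (fst r) / real (snd r) * rarr s 1 i)))"
        proof (rule runs_for_loop[where I = "\<lambda>x s'. ok s' \<and> rarr s' 0 0 = wv * dispersion (dist_entry P) A
            + (\<Sum>i<x. b i * (real (fst r) / real (snd r) * rarr s 1 i))"], goal_cases e i init upd body)
          case (body x s3)
          then show ?case by (intro runs_RAssign) (auto simp: ok_def b_def)
        qed (use rest in \<open>auto simp: ok_upd\<close>)
        then show ?case
          unfolding restrict by (rule runs_weaken) (auto simp: sum_distrib_left)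
      next
        case (rest s3)
        define V where "V = (\<lambda>(J, p, q). real p / real q * value_of P {i. i < ?n \<and> narr s a i \<in> set J})"
        have "runs P (seqs (map (\<lambda>(J, p, q).
           Seq (for_loop 6 NGroundSize (NAssign 4 (cell 6) (member J (NGet a (cell 6)))))
               (add_to_acc (RMul (ratio p q) (RValue 4)))) cs)) s3
           (length cs * ((?n * (1 + 2) + 2) + 1) + 1)
           (\<lambda>s'. ok s' \<and> rarr s' 0 0 = wv * dispersion (dist_entry P) A
            + real (fst r) / real (snd r) * (\<Sum>i\<in>A. rarr s 1 i) + sum_list (map V cs))"
        proof (rule runs_seqs[where I = "\<lambda>xs s'. ok s' \<and> rarr s' 0 0 = wv * dispersion (dist_entry P) A
            + real (fst r) / real (snd r) * (\<Sum>i\<in>A. rarr s 1 i) + sum_list (map V xs)"], goal_cases init body)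
          case (body xs x ys s4)
          obtain J p q where x: "x = (J, p, q)" by (cases x)
          show ?case unfolding x prod.case
          proof (rule runs_Seq[where R = "\<lambda>s'. array_set P s' 4 = {i. i < ?n \<and> narr s a i \<in> set J}"],
              goal_cases query acc)
            case query
            have "runs P (for_loop 6 NGroundSize (NAssign 4 (cell 6) (member J (NGet a (cell 6))))) s4
                (?n * (1 + 2) + 2) (\<lambda>s'. ok s' \<and> (\<forall>i<?n. narr s' 4 i \<noteq> 0 \<longleftrightarrow> narr s a i \<in> set J))"
            proof (rule runs_for_loop[where I = "\<lambda>x s'. ok s' \<and> (\<forall>i<x. narr s' 4 i \<noteq> 0 \<longleftrightarrow> narr s a i \<in> set J)"],
                goal_cases e i init upd body)
              case (body x s5)
              then have "narr s5 a = narr s a" by (simp add: ok_def)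
              then show ?case
                using body nval_member[of P s5 J "NGet a (cell 6)"]
                by (intro runs_NAssign) (auto simp: ok_upd less_Suc_eq)
            qed (use body in \<open>auto simp: ok_upd\<close>)
            then show ?case by (rule runs_weaken) (auto simp: array_set_def)
          next
            case (acc s5)
            have "ok s5" using body(3) ok_frame[OF _ acc(1)] by auto
            moreover have "rarr s5 0 = rarr s4 0" using acc(1) by (auto simp: frame_def)
            ultimately show ?case
              using body(3) acc(2) by (intro runs_RAssign) (auto simp: ok_def V_def)
          qed
        qed (use rest in auto)
        then show ?case by (rule runs_weaken) (auto simp: V_def A_def)
      qed
    qed
  qed
qed

section \<open>The local search as a program\<close>

text \<open>\<open>m\<close> is a constant of the program, hence so is the number of oracle queries
  per evaluation. For the empty list the denominator is 0 and the division returns 0, in agreement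
  with \<open>weight_0\<close>.\<close>

definition pot_terms :: "nat \<Rightarrow> (nat list \<times> nat \<times> nat) list" where
  "pot_terms m = map (\<lambda>J. (J, m ^ (m + 1 - length J),
     (m + 1) ^ (m + 1 - length J) * (length J * (m choose length J)))) (subseqs [1..<Suc m])"

text \<open>Cell 5 holds the rank k, so the factor of the dispersion is k/(k+2); the pair is the
  fraction \<open>decay m\<close>.\<close>

definition pot_com :: "nat \<Rightarrow> name \<Rightarrow> com" where
  "pot_com m a = evaluate a (RDiv (RNat (cell 5)) (RAdd (RNat (cell 5)) (RNat (NConst 2))))
     (m ^ m, (m + 1) ^ m) (pot_terms m)"

text \<open>The ratio 0/1 switches off the marginals, and the single query is the whole
  base.\<close>

definition val_com :: "nat \<Rightarrow> name \<Rightarrow> com" where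
  "val_com m a = evaluate a (RNat (NConst 1)) (0, 1) [([1..<Suc m], 1, 1)]"

text \<open>The label of \<open>b\<close> is read after \<open>a\<close> has been cleared in array
  2, so one test covers both \<open>b = a\<close> and \<open>b\<close> outside the base. Counter 10
  starts at 0 and the labels of parts at 1, hence the added 1.\<close>

definition try_swap :: "nat \<Rightarrow> com" where
  "try_swap m =
     Seq (copy 2 1)
    (Seq (NAssign 2 (cell 8) (NConst 0))
         (If (BAnd (NLess (NConst 0) (NGet 1 (cell 8))) (NLess (NGet 2 (cell 9)) (NConst 1)))
             (Seq (NAssign 2 (cell 9) (NAdd (cell 10) (NConst 1)))
                  (If (BIndep 2)
                      (Seq (pot_com m 2)
                           (If (RLess (rcell 2) (rcell 0))
                               (Seq (RAssign 2 (NConst 0) (rcell 0)) (copy 3 2))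
                               Skip))
                      Skip))
             Skip))"

definition sweep :: "nat \<Rightarrow> com" where
  "sweep m =
     Seq (copy 3 1)
    (Seq (pot_com m 3)
    (Seq (RAssign 2 (NConst 0) (rcell 0))
         (for_loop 8 NGroundSize (for_loop 9 NGroundSize (for_loop 10 (NConst m) (try_swap m))))))"

text \<open>The base just left is compared with the record, and the move to the best neighbour is
  unconditional. Array 3 starts as the current labelling, so the potential never drops.\<close>

definition improve :: "nat \<Rightarrow> com" where
  "improve m =
     Seq (sweep m)
    (Seq (val_com m 1)
    (Seq (If (RLess (rcell 3) (rcell 0)) (Seq (RAssign 3 (NConst 0) (rcell 0)) (copy 0 1)) Skip)
         (copy 1 3)))"

definition setup_marginals :: com where
  "setup_marginals =
     Seq (for_loop 6 NGroundSize (NAssign 4 (cell 6) (NConst 1)))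
         (for_loop 6 NGroundSize
           (Seq (RAssign 1 (cell 6) (RValue 4))
           (Seq (NAssign 4 (cell 6) (NConst 0))
           (Seq (RAssign 1 (cell 6) (RSub (RGet 1 (cell 6)) (RValue 4)))
                (NAssign 4 (cell 6) (NConst 1))))))"

text \<open>Any base would do as a start; the scan also counts the rank, which the potential
  needs.\<close>

definition greedy :: com where
  "greedy = for_loop 6 NGroundSize
     (Seq (NAssign 1 (cell 6) (NConst 1))
          (If (BIndep 1) (NAssign 5 (NConst 0) (NAdd (cell 5) (NConst 1)))
                         (NAssign 1 (cell 6) (NConst 0))))"

definition local_search :: "nat \<Rightarrow> nat \<Rightarrow> com" where
  "local_search m c =
     Seq setup_marginals
    (Seq greedy
    (Seq (copy 0 1)
    (Seq (val_com m 0)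
    (Seq (RAssign 3 (NConst 0) (rcell 0))
         (for_loop 11 (nmult c NGroundSize) (improve m))))))"

lemma evaluate_writes_iff [simp]:
  "nwrites (evaluate a w r cs) = (if cs = [] then {6, 7} else {4, 6, 7})" "rwrites (evaluate a w r cs) = {0}"
  by (cases cs) (auto simp: evaluate_def split: prod.splits)

lemma pot_terms_length [simp]: "length (pot_terms m) = 2 ^ m"
  by (simp add: pot_terms_def length_subseqs)

lemma pot_terms_nonempty [simp]: "pot_terms m \<noteq> []"
  using pot_terms_length[of m] by (metis length_0_conv power_not_zero zero_neq_numeral)

lemma com_writes [simp]:
  "nwrites (pot_com m a) = {4, 6, 7}" "rwrites (pot_com m a) = {0}"
  "nwrites (val_com m a) = {4, 6, 7}" "rwrites (val_com m a) = {0}"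
  "nwrites (try_swap m) = {2, 3, 4, 6, 7}" "rwrites (try_swap m) = {0, 2}"
  "nwrites (sweep m) = {2, 3, 4, 6, 7, 8, 9, 10}" "rwrites (sweep m) = {0, 2}"
  "nwrites (improve m) = {0, 1, 2, 3, 4, 6, 7, 8, 9, 10}" "rwrites (improve m) = {0, 2, 3}"
  "nwrites setup_marginals = {4, 6}" "rwrites setup_marginals = {1}"
  "nwrites greedy = {1, 5, 6}" "rwrites greedy = {}"
  by (auto simp: pot_com_def val_com_def try_swap_def sweep_def improve_def setup_marginals_def greedy_def)

definition pot_time :: "nat \<Rightarrow> nat \<Rightarrow> nat" where
  "pot_time m n = evaluate_time (2 ^ m) n"

definition val_time :: "nat \<Rightarrow> nat" where
  "val_time n = evaluate_time 1 n"

definition try_swap_time :: "nat \<Rightarrow> nat \<Rightarrow> nat" where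
  "try_swap_time m n = copy_time n + (1 + Suc (1 + Suc (pot_time m n + Suc (1 + copy_time n))))"

definition sweep_time :: "nat \<Rightarrow> nat \<Rightarrow> nat" where
  "sweep_time m n = copy_time n + (pot_time m n + (1 +
     (n * ((n * ((m * (try_swap_time m n + 2) + 2) + 2) + 2) + 2) + 2)))"

definition improve_time :: "nat \<Rightarrow> nat \<Rightarrow> nat" where
  "improve_time m n = sweep_time m n + (val_time n + (Suc (1 + copy_time n) + copy_time n))"

definition setup_time :: "nat \<Rightarrow> nat" where
  "setup_time n = (n * (1 + 2) + 2) + (n * ((1 + (1 + (1 + 1))) + 2) + 2)"

definition greedy_time :: "nat \<Rightarrow> nat" where
  "greedy_time n = n * ((1 + Suc 1) + 2) + 2"

definition local_search_time :: "nat \<Rightarrow> nat \<Rightarrow> nat \<Rightarrow> nat" where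
  "local_search_time m c n = setup_time n + (greedy_time n + (copy_time n + (val_time n + (1 +
     ((c * n) * (improve_time m n + 2) + 2)))))"

lemma polynomial_local_search_time: "polynomial (local_search_time m c)"
  unfolding local_search_time_def setup_time_def greedy_time_def improve_time_def sweep_time_def
    try_swap_time_def val_time_def pot_time_def evaluate_time_def copy_time_def
  by (intro polynomial_intros)

lemma sum_list_subseqs:
  fixes F :: "'b set \<Rightarrow> real"
  assumes "distinct xs"
  shows "(\<Sum>J\<leftarrow>subseqs xs. F (set J)) = (\<Sum>J\<in>Pow (set xs). F J)"
proof -
  have "(\<Sum>J\<leftarrow>subseqs xs. F (set J)) = (\<Sum>J\<leftarrow>map set (subseqs xs). F J)"
    by (simp add: comp_def)
  also have "\<dots> = (\<Sum>J\<in>set (map set (subseqs xs)). F J)"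
    using distinct_set_subseqs[OF assms] by (rule sum_list_distinct_conv_sum_set)
  also have "set (map set (subseqs xs)) = Pow (set xs)"
    using subseqs_powset[of xs] by simp
  finally show ?thesis .
qed

lemma sum_pot_terms:
  "(\<Sum>(J, p, q)\<leftarrow>pot_terms m. real p / real q * F (set J)) = (\<Sum>J\<in>Pow {1..m}. weight m (card J) * F J)"
proof -
  have "(\<Sum>(J, p, q)\<leftarrow>pot_terms m. real p / real q * F (set J))
      = (\<Sum>J\<leftarrow>subseqs [1..<Suc m]. weight m (length J) * F (set J))"
    unfolding pot_terms_def by (simp add: comp_def weight_def del: upt_Suc)
  also have "\<dots> = (\<Sum>J\<leftarrow>subseqs [1..<Suc m]. weight m (card (set J)) * F (set J))"
  proof (intro arg_cong[where f = sum_list] map_cong refl)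
    fix J assume "J \<in> set (subseqs [1..<Suc m])"
    then have "distinct J" by (rule subseqs_distinctD) simp
    then show "weight m (length J) * F (set J) = weight m (card (set J)) * F (set J)"
      by (simp add: distinct_card)
  qed
  also have "\<dots> = (\<Sum>J\<in>Pow (set [1..<Suc m]). weight m (card J) * F J)"
    by (rule sum_list_subseqs) simp
  also have "set [1..<Suc m] = {1..m}" by auto
  finally show ?thesis .
qed

section \<open>Correctness of the program on index sets\<close>

locale indexed_problem =
  fixes P :: problem and m :: nat
  assumes m_pos: "0 < m"
    and matroid: "matroid {..<ground_size P} {S. S \<subseteq> {..<ground_size P} \<and> indep P S}"
begin

abbreviation "n \<equiv> ground_size P"
abbreviation "X \<equiv> {..<n}"
abbreviation "indeps \<equiv> {S. S \<subseteq> X \<and> indep P S}"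
abbreviation "base_labels \<equiv> labelled_base m X indeps"
abbreviation "swap \<equiv> swap_ok m X indeps"

definition pot :: "(nat \<Rightarrow> nat) \<Rightarrow> real" where
  "pot = potential m X (dist_entry P) (value_of P) (real (matroid_rank indeps))"

definition val :: "(nat \<Rightarrow> nat) \<Rightarrow> real" where
  "val \<sigma> = dispersion (dist_entry P) (part X \<sigma> {1..m}) + value_of P (part X \<sigma> {1..m})"

definition ready :: "state \<Rightarrow> bool" where
  "ready s \<longleftrightarrow> narr s 5 0 = matroid_rank indeps \<and> (\<forall>i<n. rarr s 1 i = marginal X (value_of P) i)"

lemma ready_frame: "ready s \<Longrightarrow> frame M R s s' \<Longrightarrow> 5 \<notin> M \<Longrightarrow> 1 \<notin> R \<Longrightarrow> ready s'"
  by (simp add: ready_def frame_def)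

lemma labels_frame: "frame M R s s' \<Longrightarrow> a \<notin> M \<Longrightarrow> labels P s' a = labels P s a"
  by (rule labels_cong) (simp add: frame_def)

lemma array_set_part:
  assumes "\<And>i. i < n \<Longrightarrow> labels P s a i \<le> m"
  shows "array_set P s a = part X (labels P s a) {1..m}"
  using assms by (force simp: array_set_labels part_def)

lemma query_part: "{i. i < n \<and> narr s a i \<in> J} = part X (labels P s a) J"
  by (auto simp: part_def labels_def)

lemma base_labels_le: "base_labels \<sigma> \<Longrightarrow> i < n \<Longrightarrow> \<sigma> i \<le> m"
  by (auto simp: labelled_base_def)

lemma runs_pot:
  assumes "ready s" "a \<notin> {4, 6, 7}" and le: "\<And>i. i < n \<Longrightarrow> labels P s a i \<le> m"
  shows "runs P (pot_com m a) s (pot_time m n) (\<lambda>s'. rarr s' 0 0 = pot (labels P s a))"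
proof -
  let ?\<sigma> = "labels P s a" and ?k = "real (matroid_rank indeps)"
  have A: "array_set P s a = part X ?\<sigma> {1..m}" using le by (rule array_set_part)
  have "runs P (pot_com m a) s (pot_time m n) (\<lambda>s'. rarr s' 0 0
      = ?k / (?k + 2) * dispersion (dist_entry P) (array_set P s a)
        + real (fst (m ^ m, (m + 1) ^ m)) / real (snd (m ^ m, (m + 1) ^ m)) * (\<Sum>i\<in>array_set P s a. rarr s 1 i)
        + (\<Sum>(J, p, q)\<leftarrow>pot_terms m. real p / real q * value_of P {i. i < n \<and> narr s a i \<in> set J}))"
    unfolding pot_com_def pot_time_def pot_terms_length[symmetric]
    using assms(1,2) by (intro runs_evaluate) (auto simp: ready_def)
  moreover have "(\<Sum>i\<in>array_set P s a. rarr s 1 i) = (\<Sum>i\<in>part X ?\<sigma> {1..m}. marginal X (value_of P) i)"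
    unfolding A using assms(1) by (intro sum.cong) (auto simp: ready_def part_def)
  ultimately show ?thesis
    unfolding query_part sum_pot_terms[where F = "\<lambda>J. value_of P (part X ?\<sigma> J)"] A
    by (simp add: pot_def potential_def mixture_def decay_def power_divide)
qed

lemma runs_val:
  assumes "a \<notin> {4, 6, 7}" and le: "\<And>i. i < n \<Longrightarrow> labels P s a i \<le> m"
  shows "runs P (val_com m a) s (val_time n) (\<lambda>s'. rarr s' 0 0 = val (labels P s a))"
proof -
  have A: "array_set P s a = part X (labels P s a) {1..m}" using le by (rule array_set_part)
  have "set [1..<Suc m] = {1..m}" by auto
  moreover have "runs P (val_com m a) s (val_time n) (\<lambda>s'. rarr s' 0 0
      = 1 * dispersion (dist_entry P) (array_set P s a)
        + real (fst (0 :: nat, 1 :: nat)) / real (snd (0 :: nat, 1 :: nat)) * (\<Sum>i\<in>array_set P s a. rarr s 1 i)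
        + (\<Sum>(J, p, q)\<leftarrow>[([1..<Suc m], 1, 1)]. real p / real q * value_of P {i. i < n \<and> narr s a i \<in> set J}))"
  proof -
    have "val_time n = evaluate_time (length [([1..<Suc m], 1 :: nat, 1 :: nat)]) n"
      by (simp add: val_time_def)
    then show ?thesis
      unfolding val_com_def using assms(1) by (simp only:) (intro runs_evaluate, auto)
  qed
  ultimately show ?thesis
    unfolding query_part A by (simp add: val_def del: upt_Suc)
qed

text \<open>\<open>D\<close> is the set of swaps tried so far: array 3 dominates each of them and
  the current labelling. Once \<open>D\<close> holds all triples, this is steepest ascent.\<close>

definition sweep_inv :: "(nat \<times> nat \<times> nat) set \<Rightarrow> (nat \<Rightarrow> nat) \<Rightarrow> state \<Rightarrow> bool" where
  "sweep_inv D \<sigma> s \<longleftrightarrow> ready s \<and> labels P s 1 = \<sigma> \<and> base_labels (labels P s 3) \<and>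
     rarr s 2 0 = pot (labels P s 3) \<and> pot \<sigma> \<le> pot (labels P s 3) \<and>
     (\<forall>(a, b, j)\<in>D. swap \<sigma> a b j \<longrightarrow> pot (\<sigma>(a := 0, b := j)) \<le> pot (labels P s 3))"

lemma sweep_inv_frame:
  assumes "sweep_inv D \<sigma> s" "frame M R s s'" "M \<inter> {1, 3, 5} = {}" "R \<inter> {1, 2} = {}"
  shows "sweep_inv D \<sigma> s'"
proof -
  have "labels P s' 1 = labels P s 1" "labels P s' 3 = labels P s 3"
    using assms(3) by (auto intro!: labels_frame[OF assms(2)])
  moreover have "rarr s' 2 = rarr s 2" using assms(2,4) by (auto simp: frame_def)
  moreover have "ready s'" using assms by (auto simp: sweep_inv_def intro: ready_frame)
  ultimately show ?thesis using assms(1) by (simp add: sweep_inv_def)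
qed

lemma sweep_inv_nupdate: "a \<notin> {1, 3, 5} \<Longrightarrow> sweep_inv D \<sigma> s \<Longrightarrow> sweep_inv D \<sigma> (nupdate a i v s)"
  by (erule sweep_inv_frame[where M = "{a}" and R = "{}"]) (auto simp: frame_def)

lemma sweep_inv_mono: "sweep_inv D \<sigma> s \<Longrightarrow> E \<subseteq> D \<Longrightarrow> sweep_inv E \<sigma> s"
  unfolding sweep_inv_def by blast

lemma sweep_inv_skip:
  "sweep_inv D \<sigma> s \<Longrightarrow> \<not> swap \<sigma> a b j \<or> pot (\<sigma>(a := 0, b := j)) \<le> pot (labels P s 3) \<Longrightarrow>
    sweep_inv (insert (a, b, j) D) \<sigma> s"
  unfolding sweep_inv_def by auto

lemma runs_try_swap:
  assumes inv: "sweep_inv D \<sigma> s" and \<sigma>: "base_labels \<sigma>"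
    and ctr: "narr s 8 0 = a" "narr s 9 0 = b" "narr s 10 0 = j" and lt: "a < n" "b < n" "j < m"
  shows "runs P (try_swap m) s (try_swap_time m n) (sweep_inv (insert (a, b, Suc j) D) \<sigma>)"
proof -
  let ?\<tau> = "\<sigma>(a := 0, b := Suc j)"
  let ?D = "insert (a, b, Suc j) D"
  have le: "?\<tau> i \<le> m" if "i < n" for i using base_labels_le[OF \<sigma> that] lt by simp
  show ?thesis
    unfolding try_swap_def try_swap_time_def
  proof (rule runs_Seq[OF runs_copy], goal_cases _ _ _ rest)
    case (rest s1)
    have inv1: "sweep_inv D \<sigma> s1" by (rule sweep_inv_frame[OF inv rest(1)]) auto
    have ctr1: "narr s1 8 0 = a" "narr s1 9 0 = b" "narr s1 10 0 = j"
      using ctr rest(1) by (auto simp: frame_def)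
    have l1: "labels P s1 2 = \<sigma>" "labels P s1 1 = \<sigma>"
      using rest(2) inv inv1 by (auto simp: sweep_inv_def)
    show ?case
    proof (rule runs_Seq_NAssign, goal_cases)
      case 1
      define s2 where "s2 = nupdate 2 a 0 s1"
      note s2 = s2_def
      have inv2: "sweep_inv D \<sigma> s2" unfolding s2 by (rule sweep_inv_nupdate[OF _ inv1]) simp
      have ctr2: "narr s2 8 0 = a" "narr s2 9 0 = b" "narr s2 10 0 = j"
        using ctr1 by (auto simp: s2)
      have l2: "labels P s2 2 = \<sigma>(a := 0)" unfolding s2 using l1 lt by (simp add: labels_nupdate)
      have "narr s2 1 a = labels P s2 1 a" "narr s2 2 b = labels P s2 2 b"
        using lt by (auto simp: labels_def)
      then have n2: "narr s2 1 a = \<sigma> a" "narr s2 2 b = (\<sigma>(a := 0)) b"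
        using l2 inv2 by (auto simp: sweep_inv_def)
      show ?case
        unfolding nval.simps ctr1 s2_def[symmetric]
      proof (rule runs_If, goal_cases yes no)
        case no
        then have "\<not> swap \<sigma> a b (Suc j)" using ctr2 n2 by (auto simp: swap_ok_def split: if_splits)
        then show ?case by (intro runs_Skip sweep_inv_skip[OF inv2]) auto
      next
        case yes
        then have ok: "\<sigma> a \<noteq> 0" "b = a \<or> \<sigma> b = 0" using ctr2 n2 by (auto split: if_splits)
        show ?case
        proof (rule runs_Seq_NAssign, goal_cases)
          case 1
          define s3 where "s3 = nupdate 2 b (j + 1) s2"
          note s3 = s3_def
          have inv3: "sweep_inv D \<sigma> s3" unfolding s3 by (rule sweep_inv_nupdate[OF _ inv2]) simp
          have l3: "labels P s3 2 = ?\<tau>" unfolding s3 using l2 lt by (simp add: labels_nupdate)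
          \<comment> \<open>The oracle sees the nonzero entries of array 2, which form the new base
            because all labels are at most \<open>m\<close>. Its answer is the last condition of
            \<open>swap_ok\<close>.\<close>
          have "array_set P s3 2 = part X ?\<tau> {1..m}"
            unfolding l3[symmetric] by (rule array_set_part) (use le l3 in auto)
          then have indep: "bval P s3 (BIndep 2) \<longleftrightarrow> swap \<sigma> a b (Suc j)"
            using ok lt by (auto simp: swap_ok_def part_def)
          show ?case
            unfolding nval.simps ctr2 s3_def[symmetric]
          proof (rule runs_If, goal_cases yes no)
            case no
            then show ?case using indep by (intro runs_Skip sweep_inv_skip[OF inv3]) auto
          next
            case yes
            then have sw: "swap \<sigma> a b (Suc j)" using indep by simp
            show ?case
            proof (rule runs_Seq[OF runs_pot], goal_cases _ _ _ rest)
              case (rest s4)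
              have inv4: "sweep_inv D \<sigma> s4" by (rule sweep_inv_frame[OF inv3 rest(1)]) auto
              have l4: "labels P s4 2 = ?\<tau>" using l3 labels_frame[OF rest(1), of 2] by simp
              have r4: "rarr s4 0 0 = pot ?\<tau>" using rest(2) l3 by simp
              show ?case
              proof (rule runs_If, goal_cases yes no)
                case no
                then have "pot ?\<tau> \<le> pot (labels P s4 3)" using r4 inv4 by (auto simp: sweep_inv_def)
                then show ?case by (intro runs_Skip sweep_inv_skip[OF inv4]) auto
              next
                case yes
                then have better: "pot (labels P s4 3) < pot ?\<tau>" using r4 inv4 by (auto simp: sweep_inv_def)
                show ?case
                proof (rule runs_Seq_RAssign, goal_cases)
                  case 1
                  define s5 where "s5 = rupdate 2 0 (pot ?\<tau>) s4"
                  note s5 = s5_def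
                  have "labels P s5 x = labels P s4 x" for x
                    by (rule labels_cong) (simp add: s5)
                  then have l5: "labels P s5 2 = ?\<tau>" "labels P s5 1 = \<sigma>"
                    using l4 inv4 by (auto simp: sweep_inv_def)
                  have "ready s5" using inv4 by (auto simp: s5 ready_def sweep_inv_def)
                  have base: "base_labels ?\<tau>" using \<sigma> sw by (intro labelled_base_swap) auto
                  show ?case
                    unfolding nval.simps rval.simps r4 s5_def[symmetric]
                  proof (rule runs_weaken[OF runs_copy], goal_cases _ _ _ _ final)
                    case (final s6)
                    have "ready s6" using \<open>ready s5\<close> by (rule ready_frame[OF _ final(1)]) auto
                    moreover have "labels P s6 1 = \<sigma>" using l5 labels_frame[OF final(1), of 1] by simp
                    moreover have "labels P s6 3 = ?\<tau>" using final(2) l5 by simp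
                    moreover have "rarr s6 2 0 = pot ?\<tau>" using final(1) by (simp add: frame_def s5)
                    moreover have "pot \<sigma> \<le> pot ?\<tau>"
                        "\<forall>(a, b, j)\<in>D. swap \<sigma> a b j \<longrightarrow> pot (\<sigma>(a := 0, b := j)) \<le> pot ?\<tau>"
                      using inv4 better by (fastforce simp: sweep_inv_def)+
                    ultimately show ?case using base by (simp add: sweep_inv_def)
                  qed auto
                qed
              qed
            qed (use inv3 le l3 in \<open>auto simp: sweep_inv_def\<close>)
          qed
        qed
      qed
    qed
  qed auto
qed

text \<open>The tried triples grow lexicographically with the three counters; finishing an inner
  loop closes a slice of the enclosing set.\<close>

lemma runs_sweep:
  assumes r: "ready s" and base: "base_labels (labels P s 1)"
  shows "runs P (sweep m) s (sweep_time m n) (sweep_inv (X \<times> X \<times> {1..m}) (labels P s 1))"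
proof -
  let ?\<sigma> = "labels P s 1"
  show ?thesis
    unfolding sweep_def sweep_time_def
  proof (rule runs_Seq[OF runs_copy], goal_cases _ _ _ rest)
    case (rest s1)
    have r1: "ready s1" using r by (rule ready_frame[OF _ rest(1)]) auto
    have l1: "labels P s1 1 = ?\<sigma>" "labels P s1 3 = ?\<sigma>"
      using rest(2) labels_frame[OF rest(1), of 1] by auto
    show ?case
    proof (rule runs_Seq[OF runs_pot], goal_cases _ _ _ rest)
      case (rest s2)
      have r2: "ready s2" using r1 by (rule ready_frame[OF _ rest(1)]) auto
      have l2: "labels P s2 1 = ?\<sigma>" "labels P s2 3 = ?\<sigma>"
        using l1 labels_frame[OF rest(1), of 1] labels_frame[OF rest(1), of 3] by auto
      show ?case
      proof (rule runs_Seq_RAssign, goal_cases)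
        case 1
        define s3 where "s3 = rupdate 2 0 (pot ?\<sigma>) s2"
        have "labels P s3 a = labels P s2 a" for a by (rule labels_cong) (simp add: s3_def)
        moreover have "ready s3" using r2 by (simp add: ready_def s3_def)
        moreover have "rarr s3 2 0 = pot ?\<sigma>" by (simp add: s3_def)
        ultimately have inv3: "sweep_inv {} ?\<sigma> s3" using l2 base by (simp add: sweep_inv_def)
        have pot2: "rarr s2 0 0 = pot ?\<sigma>" using rest(2) l1 by simp
        show ?case
          unfolding nval.simps rval.simps pot2 s3_def[symmetric]
        proof (rule runs_weaken[OF runs_for_loop[where N = n and T = "n * ((m * (try_swap_time m n + 2) + 2) + 2) + 2"
              and I = "\<lambda>x. sweep_inv ({..<x} \<times> X \<times> {1..m}) ?\<sigma>"]], goal_cases e i init upd body T res)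
          case (body x s4)
          show ?case
          proof (rule runs_weaken[OF runs_for_loop[where N = n and T = "m * (try_swap_time m n + 2) + 2"
                and I = "\<lambda>y. sweep_inv ({..<x} \<times> X \<times> {1..m} \<union> {x} \<times> {..<y} \<times> {1..m}) ?\<sigma>"]],
              goal_cases e i init upd body T res)
            case (body y s5)
            have x5: "narr s5 8 0 = x" using body(2) \<open>narr s4 8 0 = x\<close> by (simp add: frame_def)
            show ?case
            proof (rule runs_weaken[OF runs_for_loop[where N = m and T = "try_swap_time m n"
                  and I = "\<lambda>z. sweep_inv ({..<x} \<times> X \<times> {1..m} \<union> {x} \<times> {..<y} \<times> {1..m} \<union> {x} \<times> {y} \<times> {1..z}) ?\<sigma>"]],
                goal_cases e i init upd body T res)
              case (body z s6)
              let ?D = "\<lambda>z. {..<x} \<times> X \<times> {1..m} \<union> {x} \<times> {..<y} \<times> {1..m} \<union> {x} \<times> {y} \<times> {1..z}"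
              have "narr s6 8 0 = x" "narr s6 9 0 = y"
                using body(2) x5 \<open>narr s5 9 0 = y\<close> by (simp_all add: frame_def)
              from runs_try_swap[OF body(4) base this body(3) \<open>x < n\<close> \<open>y < n\<close> body(1)]
              show ?case
              proof (rule runs_weaken)
                fix s' assume "sweep_inv (insert (x, y, Suc z) (?D z)) ?\<sigma> s'"
                then show "sweep_inv (?D (Suc z)) ?\<sigma> s'" by (rule sweep_inv_mono) auto
              qed simp
            next
              case (res s6)
              then show ?case by (auto elim!: sweep_inv_mono)
            qed (use body in \<open>auto intro: sweep_inv_nupdate sweep_inv_mono\<close>)
          next
            case (res s5)
            then show ?case by (auto elim!: sweep_inv_mono)
          qed (use body in \<open>auto intro: sweep_inv_nupdate sweep_inv_mono\<close>)
        next
          case (res s4)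
          then show ?case by (auto elim!: sweep_inv_mono)
        qed (use inv3 in \<open>auto intro: sweep_inv_nupdate sweep_inv_mono\<close>)
      qed
    qed (use r1 l1 base_labels_le[OF base] in auto)
  qed auto
qed

text \<open>The search does not know the optimum, so its invariant covers all thresholds \<open>\<Theta>\<close> and gains \<open>\<delta>\<close>
  at once.\<close>

definition ascent :: "real \<Rightarrow> real \<Rightarrow> bool" where
  "ascent \<Theta> \<delta> \<longleftrightarrow> (\<forall>\<sigma>. base_labels \<sigma> \<longrightarrow> 0 \<le> pot \<sigma> \<and>
     (val \<sigma> < \<Theta> \<longrightarrow> (\<exists>a b j. swap \<sigma> a b j \<and> pot \<sigma> + \<delta> \<le> pot (\<sigma>(a := 0, b := j)))))"

text \<open>While the record is below \<open>\<Theta>\<close>, every step so far has gained at least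
  \<open>\<delta>\<close> in potential. Before the first step this says \<open>0 \<le> pot\<close>,
  which \<open>ascent\<close> includes for that reason.\<close>

definition search_inv :: "nat \<Rightarrow> state \<Rightarrow> bool" where
  "search_inv t s \<longleftrightarrow> ready s \<and> base_labels (labels P s 1) \<and> base_labels (labels P s 0) \<and>
     rarr s 3 0 = val (labels P s 0) \<and>
     (\<forall>\<Theta> \<delta>. ascent \<Theta> \<delta> \<longrightarrow> \<Theta> \<le> val (labels P s 0) \<or> real t * \<delta> \<le> pot (labels P s 1))"

lemma runs_improve:
  assumes inv: "search_inv t s"
  shows "runs P (improve m) s (improve_time m n) (search_inv (Suc t))"
proof -
  let ?\<sigma> = "labels P s 1" and ?\<omega> = "labels P s 0"
  have \<sigma>: "base_labels ?\<sigma>" "base_labels ?\<omega>" and r: "ready s" using inv by (auto simp: search_inv_def)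
  define best where "best = (\<lambda>\<tau> s'. ready s' \<and> base_labels \<tau> \<and> pot ?\<sigma> \<le> pot \<tau> \<and>
    (\<forall>a b j. swap ?\<sigma> a b j \<longrightarrow> pot (?\<sigma>(a := 0, b := j)) \<le> pot \<tau>))"
  show ?thesis
    unfolding improve_def improve_time_def
  proof (rule runs_Seq[OF runs_sweep], goal_cases _ _ rest)
    case (rest s1)
    have best1: "best (labels P s1 3) s1" and l1: "labels P s1 1 = ?\<sigma>"
      using rest(2) by (auto simp: sweep_inv_def best_def swap_ok_def)
    have o1: "labels P s1 0 = ?\<omega>" "rarr s1 3 = rarr s 3"
      using labels_frame[OF rest(1), of 0] rest(1) by (auto simp: frame_def)
    show ?case
    proof (rule runs_Seq[OF runs_val], goal_cases _ _ rest)
      case (rest s2)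
      have r2: "ready s2" using best1 unfolding best_def by (auto intro: ready_frame[OF _ rest(1)])
      have l2: "labels P s2 1 = ?\<sigma>" "labels P s2 3 = labels P s1 3" "labels P s2 0 = ?\<omega>"
        using l1 o1 labels_frame[OF rest(1), of 1] labels_frame[OF rest(1), of 3]
          labels_frame[OF rest(1), of 0] by auto
      have best2: "best (labels P s2 3) s2" using best1 r2 l2 by (simp add: best_def)
      have v2: "rarr s2 0 0 = val ?\<sigma>" "rarr s2 3 0 = val ?\<omega>"
        using rest l1 o1 inv by (auto simp: frame_def search_inv_def)
      define kept where "kept = (\<lambda>s'. best (labels P s' 3) s' \<and> base_labels (labels P s' 0) \<and>
        rarr s' 3 0 = val (labels P s' 0) \<and> val ?\<sigma> \<le> val (labels P s' 0) \<and> val ?\<omega> \<le> val (labels P s' 0))"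
      show ?case
      proof (rule runs_Seq[where R = kept], goal_cases update rest)
        case update
        show ?case
        proof (rule runs_If, goal_cases yes no)
          case no
          then show ?case
            using best2 l2 v2 \<sigma> by (intro runs_Skip) (auto simp: kept_def)
        next
          case yes
          then have better: "val ?\<omega> < val ?\<sigma>" using v2 by simp
          show ?case
          proof (rule runs_Seq_RAssign, goal_cases)
            case 1
            define s3 where "s3 = rupdate 3 0 (val ?\<sigma>) s2"
            have l3: "labels P s3 a = labels P s2 a" for a by (rule labels_cong) (simp add: s3_def)
            have r3: "ready s3" using r2 by (simp add: ready_def s3_def)
            show ?case
              unfolding nval.simps rval.simps v2 s3_def[symmetric]
            proof (rule runs_weaken[OF runs_copy], goal_cases _ _ _ _ final)
              case (final s4)
              have "ready s4" using r3 by (rule ready_frame[OF _ final(1)]) auto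
              moreover have "labels P s4 3 = labels P s2 3" "labels P s4 0 = ?\<sigma>"
                using labels_frame[OF final(1), of 3] final(2) l2 l3 by auto
              moreover have "rarr s4 3 0 = val ?\<sigma>" using final(1) by (simp add: frame_def s3_def)
              ultimately show ?case using best2 better \<sigma> by (simp add: kept_def best_def)
            qed auto
          qed
        qed
      next
        case (rest s3)
        show ?case
        proof (rule runs_weaken[OF runs_copy], goal_cases _ _ _ _ final)
          case (final s4)
          have "labels P s4 1 = labels P s3 3" "labels P s4 0 = labels P s3 0"
            using labels_frame[OF final(1), of 0] final(2) by auto
          moreover have "ready s4" using rest(2) unfolding kept_def best_def
            by (auto intro: ready_frame[OF _ final(1)])
          moreover have "rarr s4 3 = rarr s3 3" using final(1) by (simp add: frame_def)
          moreover have "\<Theta> \<le> val (labels P s3 0) \<or> real (Suc t) * \<delta> \<le> pot (labels P s3 3)"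
            if asc: "ascent \<Theta> \<delta>" for \<Theta> \<delta>
          proof (cases "\<Theta> \<le> val (labels P s3 0)")
            case False
            \<comment> \<open>The record already accounts for the base just left, so that base lies
              below \<open>\<Theta>\<close> as well and a swap gaining \<open>\<delta>\<close> was
              open to the sweep.\<close>
            then have "val ?\<sigma> < \<Theta>" "val ?\<omega> < \<Theta>" using rest(2) by (auto simp: kept_def)
            then obtain a b j where "swap ?\<sigma> a b j" "pot ?\<sigma> + \<delta> \<le> pot (?\<sigma>(a := 0, b := j))"
              using asc \<sigma> unfolding ascent_def by blast
            moreover have "real t * \<delta> \<le> pot ?\<sigma>"
              using inv asc \<open>val ?\<omega> < \<Theta>\<close> unfolding search_inv_def by force
            ultimately have "real (Suc t) * \<delta> \<le> pot (?\<sigma>(a := 0, b := j))" by (simp add: algebra_simps)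
            also have "\<dots> \<le> pot (labels P s3 3)"
              using rest(2) \<open>swap ?\<sigma> a b j\<close> unfolding kept_def best_def by blast
            finally show ?thesis ..
          qed simp
          ultimately show ?case using rest(2) by (simp add: search_inv_def kept_def best_def)
        qed auto
      qed
    qed (use l1 base_labels_le[OF \<sigma>(1)] in auto)
  qed (use r \<sigma> in auto)
qed

lemma array_set_upd:
  assumes "i < n"
  shows "array_set P (nupdate a i (Suc 0) s) a = insert i (array_set P s a)"
    and "array_set P (nupdate a i 0 s) a = array_set P s a - {i}"
  using assms by (auto simp: array_set_def)

lemma array_set_cong: "narr s' a = narr s a \<Longrightarrow> array_set P s' a = array_set P s a"
  by (simp add: array_set_def)

lemma runs_setup_marginals:
  "runs P setup_marginals s (setup_time n) (\<lambda>s'. \<forall>i<n. rarr s' 1 i = marginal X (value_of P) i)"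
  unfolding setup_marginals_def setup_time_def
proof (rule runs_Seq[where R = "\<lambda>s'. \<forall>i<n. narr s' 4 i \<noteq> 0"], goal_cases fill rest)
  case fill
  show ?case
  proof (rule runs_for_loop[where I = "\<lambda>x s'. \<forall>i<x. narr s' 4 i \<noteq> 0"], goal_cases e i init upd body)
    case (body x s')
    then show ?case by (intro runs_NAssign) (auto simp: less_Suc_eq)
  qed auto
next
  case (rest s1)
  have "runs P (for_loop 6 NGroundSize
           (Seq (RAssign 1 (cell 6) (RValue 4))
           (Seq (NAssign 4 (cell 6) (NConst 0))
           (Seq (RAssign 1 (cell 6) (RSub (RGet 1 (cell 6)) (RValue 4)))
                (NAssign 4 (cell 6) (NConst 1)))))) s1 (n * ((1 + (1 + (1 + 1))) + 2) + 2)
      (\<lambda>s'. (\<forall>i<n. narr s' 4 i \<noteq> 0) \<and> (\<forall>i<n. rarr s' 1 i = marginal X (value_of P) i))"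
  proof (rule runs_for_loop[where I = "\<lambda>x s'. (\<forall>i<n. narr s' 4 i \<noteq> 0) \<and>
      (\<forall>i<x. rarr s' 1 i = marginal X (value_of P) i)"], goal_cases e i init upd body)
    case (body x s2)
    have full: "array_set P s2 4 = X" using body(4) by (auto simp: array_set_def)
    have hole: "array_set P (nupdate 4 x 0 (rupdate 1 x (value_of P X) s2)) 4 = X - {x}"
      using full body(1) array_set_cong[of "rupdate 1 x (value_of P X) s2" 4 s2] by (simp add: array_set_upd)
    show ?case
      by (intro runs_Seq_RAssign runs_Seq_NAssign runs_NAssign)
        (use body full hole in \<open>auto simp: marginal_def less_Suc_eq\<close>)
  qed (use rest in auto)
  then show ?case by (rule runs_weaken) auto
qed

text \<open>An element once rejected stays rejected as the set grows, because independence passes to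
  subsets. The final set is thus maximal, and exchange with a base shows that it has full
  rank.\<close>

lemma runs_greedy:
  assumes init: "narr s 1 = (\<lambda>_. 0)" "narr s 5 0 = 0"
  shows "runs P greedy s (greedy_time n)
    (\<lambda>s'. narr s' 5 0 = matroid_rank indeps \<and> base_labels (labels P s' 1))"
proof -
  define I where "I = (\<lambda>x s'. array_set P s' 1 \<subseteq> {..<x} \<and> array_set P s' 1 \<in> indeps \<and>
    (\<forall>i. narr s' 1 i \<le> 1) \<and> narr s' 5 0 = card (array_set P s' 1) \<and>
    (\<forall>i<x. i \<notin> array_set P s' 1 \<longrightarrow> insert i (array_set P s' 1) \<notin> indeps))"
  have "runs P greedy s (greedy_time n) (I n)"
    unfolding greedy_def greedy_time_def
  proof (rule runs_for_loop[where I = I], goal_cases e i init upd body)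
    case init
    have "array_set P s 1 = {}" using assms by (auto simp: array_set_def)
    moreover have "{} \<in> indeps" using matroid_empty[OF matroid] .
    ultimately show ?case using assms by (simp add: I_def)
  next
    case (upd x v s')
    have "array_set P (nupdate 6 0 v s') 1 = array_set P s' 1" by (rule array_set_cong) simp
    then show ?case using upd unfolding I_def by simp
  next
    case (body x s')
    let ?S = "array_set P s' 1"
    define s1 where "s1 = nupdate 1 x 1 s'"
    have S1: "array_set P s1 1 = insert x ?S" using body(1) by (simp add: s1_def array_set_upd)
    have xS: "x \<notin> ?S" using body(4) by (auto simp: I_def)
    have fS: "finite ?S" using body(4) finite_subset by (auto simp: I_def)
    show ?case
    proof (rule runs_Seq_NAssign, goal_cases)
      case 1
      show ?case
        unfolding nval.simps body(3) s1_def[symmetric]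
      proof (rule runs_If, goal_cases yes no)
        case yes
        then have ind: "insert x ?S \<in> indeps" using body S1 by (auto simp: I_def)
        define s2 where "s2 = nupdate 5 0 (narr s1 5 0 + 1) s1"
        have S2: "array_set P s2 1 = insert x ?S" unfolding S1[symmetric] by (rule array_set_cong) (simp add: s2_def)
        have "insert i (insert x ?S) \<notin> indeps" if "i < Suc x" "i \<notin> insert x ?S" for i
        proof
          assume "insert i (insert x ?S) \<in> indeps"
          then have "insert i ?S \<in> indeps" by (rule matroid_down[OF matroid]) auto
          then show False using that body(4) by (auto simp: I_def less_Suc_eq)
        qed
        then have "I (Suc x) s2"
          using ind body(4) xS fS unfolding I_def S2 by (auto simp: s2_def s1_def)
        then show ?case by (intro runs_NAssign) (simp add: s2_def)
      next
        case no
        then have ind: "insert x ?S \<notin> indeps" using S1 by simp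
        define s2 where "s2 = nupdate 1 x 0 s1"
        have S2: "array_set P s2 1 = ?S" using body(1) S1 xS by (simp add: s2_def array_set_upd)
        have "I (Suc x) s2"
          using ind body(4) unfolding I_def S2 by (auto simp: s2_def s1_def less_Suc_eq)
        moreover have "nval P s1 (cell 6) = x" using body(3) by (simp add: s1_def)
        ultimately show ?case by (intro runs_NAssign) (simp add: s2_def)
      qed
    qed
  qed auto
  then show ?thesis
  proof (rule runs_weaken)
    fix s' assume I: "I n s'"
    let ?S = "array_set P s' 1"
    have S: "?S \<in> indeps" using I by (simp add: I_def)
    have "card ?S = matroid_rank indeps"
    proof (rule ccontr)
      assume "card ?S \<noteq> matroid_rank indeps"
      then have "card ?S < matroid_rank indeps" using matroid_rank_ge[OF matroid S] by simp
      moreover obtain B where "B \<in> indeps" "card B = matroid_rank indeps"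
        using matroid_rank_attained[OF matroid] by auto
      ultimately obtain x where x: "x \<in> B - ?S" "insert x ?S \<in> indeps"
        using matroid_exchange[OF matroid S] by metis
      then have "x < n" by auto
      then show False using x I unfolding I_def by blast
    qed
    moreover have le: "labels P s' 1 i \<le> m" for i
    proof -
      have "narr s' 1 i \<le> 1" using I by (simp only: I_def)
      then show ?thesis using m_pos by (simp add: labels_def)
    qed
    moreover have "?S = part X (labels P s' 1) {1..m}" using le by (rule array_set_part)
    ultimately show "narr s' 5 0 = matroid_rank indeps \<and> base_labels (labels P s' 1)"
      using I S by (auto simp: labelled_base_def I_def)
  qed simp
qed

lemma runs_local_search:
  "runs P (local_search m c) initial_state (local_search_time m c n)
    (\<lambda>s. base_labels (labels P s 0) \<and> (\<forall>\<Theta> \<delta>. ascent \<Theta> \<delta> \<longrightarrow>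
       \<Theta> \<le> val (labels P s 0) \<or> (\<exists>\<sigma>. base_labels \<sigma> \<and> real (c * n) * \<delta> \<le> pot \<sigma>)))"
  unfolding local_search_def local_search_time_def
proof (rule runs_Seq[OF runs_setup_marginals], goal_cases rest)
  case (rest s1)
  have init: "narr s1 1 = (\<lambda>_. 0)" "narr s1 5 0 = 0"
    using rest(1) by (auto simp: frame_def initial_state_def)
  show ?case
  proof (rule runs_Seq[OF runs_greedy[OF init]], goal_cases rest)
    case (rest s2)
    have r2: "ready s2" using rest \<open>\<forall>i<n. rarr s1 1 i = _ i\<close> by (auto simp: ready_def frame_def)
    show ?case
    proof (rule runs_Seq[OF runs_copy], goal_cases _ _ _ rest)
      case (rest s3)
      have r3: "ready s3" using r2 by (rule ready_frame[OF _ rest(1)]) auto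
      have l3: "base_labels (labels P s3 1)" "base_labels (labels P s3 0)"
        using rest(2) labels_frame[OF rest(1), of 1] \<open>_ \<and> base_labels (labels P s2 1)\<close> by auto
      show ?case
      proof (rule runs_Seq[OF runs_val], goal_cases _ _ rest)
        case (rest s4)
        have r4: "ready s4" using r3 by (rule ready_frame[OF _ rest(1)]) auto
        have l4: "labels P s4 1 = labels P s3 1" "labels P s4 0 = labels P s3 0"
          using labels_frame[OF rest(1)] by auto
        show ?case
        proof (rule runs_Seq_RAssign, goal_cases)
          case 1
          define s5 where "s5 = rupdate 3 (nval P s4 (NConst 0)) (rval P s4 (rcell 0)) s4"
          have l5: "labels P s5 a = labels P s4 a" for a by (rule labels_cong) (simp add: s5_def)
          have "ready s5" using r4 by (simp add: ready_def s5_def)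
          moreover have "rarr s5 3 0 = val (labels P s5 0)" using rest(2) l4 l5 by (simp add: s5_def)
          ultimately have inv: "search_inv 0 s5"
            using l3 l4 l5 by (auto simp: search_inv_def ascent_def)
          show ?case
            unfolding s5_def[symmetric]
          proof (rule runs_weaken[OF runs_for_loop[where N = "c * n" and T = "improve_time m n" and I = search_inv]],
              goal_cases e i init upd body T res)
            case (upd x v s)
            have "labels P (nupdate 11 0 v s) 0 = labels P s 0" "labels P (nupdate 11 0 v s) 1 = labels P s 1"
              by (rule labels_cong; simp)+
            then show ?case using upd by (simp add: search_inv_def ready_def)
          next
            case (res s6)
            then show ?case unfolding search_inv_def by blast
          qed (use inv runs_improve in auto)
        qed
      qed (use l3 base_labels_le in auto)
    qed auto
  qed
qed

end

section \<open>The approximation guarantee\<close>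

text \<open>Below the threshold the deficit exceeds \<open>\<eta> * G\<close>, so some swap gains
  \<open>\<eta> * G / k\<close>. Had the record stayed there throughout, \<open>c * n\<close> such
  gains would exceed \<open>(m + 1) * G\<close>, as \<open>k \<le> n\<close>, contrary to the bound
  on the potential.\<close>

lemma (in indexed_problem) local_search_guarantee:
  fixes \<eta> G :: real
  defines "k \<equiv> real (matroid_rank indeps)"
  assumes d: "distance_on X (dist_entry P)" "negative_type_on X (dist_entry P)"
    and f0: "\<And>A. A \<subseteq> X \<Longrightarrow> 0 \<le> value_of P A"
    and mono: "mono_on (Pow X) (value_of P)" and sm: "submodular_on X (value_of P)"
    and k: "0 < matroid_rank indeps" and B: "B \<in> indeps" "card B = matroid_rank indeps"
    and G: "0 < G" "\<And>S. S \<in> indeps \<Longrightarrow> dispersion (dist_entry P) S + value_of P S \<le> G"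
    and \<eta>: "0 < \<eta>" "real (m + 1) < real c * \<eta>"
    and result: "\<And>\<Theta> \<delta>. ascent \<Theta> \<delta> \<Longrightarrow>
      \<Theta> \<le> val \<omega> \<or> (\<exists>\<sigma>. base_labels \<sigma> \<and> real (c * n) * \<delta> \<le> pot \<sigma>)"
  shows "(1 - 4 / (k + 2)) * dispersion (dist_entry P) B + (1 - decay m) * value_of P B
      + decay m * (\<Sum>x\<in>B. marginal X (value_of P) x) + decay m * value_of P {} - \<eta> * G \<le> val \<omega>"
    (is "?T - _ \<le> _")
proof -
  have fin: "finite X" by simp
  have k0: "0 < k" using k by (simp add: k_def)
  have kn: "k \<le> real n"
    using B card_mono[of X B] by (simp add: k_def)
  have asc: "ascent (?T - \<eta> * G) (\<eta> * G / k)"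
    unfolding ascent_def
  proof (intro allI impI conjI)
    fix \<sigma> assume \<sigma>: "base_labels \<sigma>"
    show "0 \<le> pot \<sigma>"
      unfolding pot_def by (rule potential_bounds(1)[OF fin d(1) f0 mono sm of_nat_0_le_iff refl])
    assume less: "val \<sigma> < ?T - \<eta> * G"
    obtain a b j where sw: "swap \<sigma> a b j"
        "pot \<sigma> + (?T - val \<sigma>) / k \<le> pot (\<sigma>(a := 0, b := j))"
      using improving_swap[OF matroid d mono sm m_pos _ k0 \<sigma> refl B refl]
      unfolding pot_def val_def k_def by blast
    have "\<eta> * G / k \<le> (?T - val \<sigma>) / k"
      using less k0 by (intro divide_right_mono) auto
    then show "\<exists>a b j. swap \<sigma> a b j \<and> pot \<sigma> + \<eta> * G / k \<le> pot (\<sigma>(a := 0, b := j))"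
      using sw by force
  qed
  have "\<not> (\<exists>\<sigma>. base_labels \<sigma> \<and> real (c * n) * (\<eta> * G / k) \<le> pot \<sigma>)"
  proof clarify
    fix \<sigma> assume \<sigma>: "base_labels \<sigma>" and le: "real (c * n) * (\<eta> * G / k) \<le> pot \<sigma>"
    have "pot \<sigma> \<le> real (m + 1) * val \<sigma>"
      unfolding pot_def val_def by (rule potential_bounds(2)[OF fin d(1) f0 mono sm of_nat_0_le_iff refl])
    also have "\<dots> \<le> real (m + 1) * G"
      using \<sigma> unfolding val_def labelled_base_def by (intro mult_left_mono G(2)) auto
    also have "\<dots> < real c * \<eta> * G" using \<eta>(2) G(1) by (rule mult_strict_right_mono)
    also have "\<dots> = real c * \<eta> * G * 1" by simp
    also have "\<dots> \<le> real c * \<eta> * G * (real n / k)"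
      using kn k0 \<eta>(1) G(1) by (intro mult_left_mono) auto
    finally show False using le by (simp add: mult_ac)
  qed
  then show ?thesis using result[OF asc] by blast
qed

lemma decay_limit: "decay \<longlonglongrightarrow> 1 / exp 1"
proof -
  have "(\<lambda>m. inverse ((1 + 1 / real m) ^ m)) \<longlonglongrightarrow> inverse (exp 1 :: real)"
    by (intro tendsto_inverse tendsto_exp_limit_sequentially) simp
  moreover have "\<forall>\<^sub>F m in sequentially. inverse ((1 + 1 / real m) ^ m) = decay m"
    using eventually_gt_at_top[of 0]
  proof eventually_elim
    case (elim m)
    then have "inverse (1 + 1 / real m) = real m / real (m + 1)" by (simp add: field_simps)
    then show ?case unfolding decay_def by (simp flip: power_inverse)
  qed
  ultimately show ?thesis by (simp add: tendsto_cong inverse_eq_divide)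
qed

lemma encode_simps [simp]:
  "ground_size (encode en X d f \<I>) = card X"
  "dist_entry (encode en X d f \<I>) = (\<lambda>i j. d (en i) (en j))"
  "value_of (encode en X d f \<I>) = (\<lambda>S. f (en ` S))"
  "indep (encode en X d f \<I>) = (\<lambda>S. en ` S \<in> \<I>)"
  by (simp_all add: encode_def)

section \<open>Transfer along the enumeration of the ground set\<close>

context
  fixes en :: "nat \<Rightarrow> 'a" and X :: "'a set" and d :: "'a \<Rightarrow> 'a \<Rightarrow> real"
    and f :: "'a set \<Rightarrow> real" and \<I> :: "'a set set"
  assumes en: "bij_betw en {..<card X} X"
begin

abbreviation (input) "enc \<equiv> encode en X d f \<I>"
abbreviation (input) "enc_indeps \<equiv> {S. S \<subseteq> {..<ground_size enc} \<and> indep enc S}"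

lemma en_in: "i < card X \<Longrightarrow> en i \<in> X"
  using en by (auto simp: bij_betw_def)

lemma en_subset: "S \<subseteq> {..<card X} \<Longrightarrow> en ` S \<subseteq> X"
  using en by (auto simp: bij_betw_def)

lemma en_inj: "S \<subseteq> {..<card X} \<Longrightarrow> inj_on en S"
  using en inj_on_subset by (auto simp: bij_betw_def)

lemma en_card: "S \<subseteq> {..<card X} \<Longrightarrow> card (en ` S) = card S"
  by (rule card_image) (rule en_inj)

lemma en_preimage:
  assumes "S \<subseteq> X"
  shows "\<exists>S'\<subseteq>{..<card X}. en ` S' = S"
  using assms en subset_image_iff[of S en "{..<card X}"] by (auto simp: bij_betw_def)

lemma distance_on_encode: "distance_on X d \<Longrightarrow> distance_on {..<card X} (dist_entry enc)"
  unfolding distance_on_def using en_in by simp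

lemma negative_type_on_encode:
  assumes "negative_type_on X d"
  shows "negative_type_on {..<card X} (dist_entry enc)"
  unfolding negative_type_on_def
proof (intro allI impI)
  fix x :: "nat \<Rightarrow> real" assume x: "(\<Sum>i<card X. x i) = 0"
  define y where "y = x \<circ> inv_into {..<card X} en"
  have y: "y (en i) = x i" if "i < card X" for i
    using that en_inj[of "{..<card X}"] by (simp add: y_def)
  have re: "(\<Sum>a\<in>X. h a) = (\<Sum>i<card X. h (en i))" for h :: "'a \<Rightarrow> real"
    using sum.reindex_bij_betw[OF en, of h] by simp
  have "(\<Sum>a\<in>X. y a) = 0" using x by (simp add: re y)
  then have "(\<Sum>a\<in>X. \<Sum>b\<in>X. y a * d a b * y b) \<le> 0"
    using assms unfolding negative_type_on_def by blast
  then show "(\<Sum>i<card X. \<Sum>j<card X. x i * dist_entry enc i j * x j) \<le> 0"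
    by (simp add: re y)
qed

lemma mono_on_encode:
  assumes "mono_on (Pow X) f"
  shows "mono_on (Pow {..<card X}) (value_of enc)"
proof (rule mono_onI)
  fix S T assume "S \<in> Pow {..<card X}" "T \<in> Pow {..<card X}" "S \<subseteq> T"
  then have "en ` S \<in> Pow X" "en ` T \<in> Pow X" "en ` S \<subseteq> en ` T"
    using en_subset by auto
  then show "value_of enc S \<le> value_of enc T" using mono_onD[OF assms] by simp
qed

lemma submodular_on_encode:
  assumes "submodular_on X f"
  shows "submodular_on {..<card X} (value_of enc)"
  unfolding submodular_on_def
proof (intro allI impI)
  fix A B assume AB: "A \<subseteq> {..<card X}" "B \<subseteq> {..<card X}"
  then have "en ` (A \<inter> B) = en ` A \<inter> en ` B"
    by (intro inj_on_image_Int[OF en_inj[OF order_refl]])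
  then show "value_of enc (A \<union> B) + value_of enc (A \<inter> B) \<le> value_of enc A + value_of enc B"
    using submodularD[OF assms en_subset[OF AB(1)] en_subset[OF AB(2)]] by (simp add: image_Un)
qed

lemma matroid_encode:
  assumes M: "matroid X \<I>"
  shows "matroid {..<ground_size enc} enc_indeps"
  unfolding matroid_def
proof (intro conjI allI impI)
  show "{} \<in> enc_indeps" using matroid_empty[OF M] by simp
next
  fix A B assume "B \<in> enc_indeps" "A \<subseteq> B"
  then show "A \<in> enc_indeps" using matroid_down[OF M, of "en ` B" "en ` A"] by auto
next
  fix A B assume A: "A \<in> enc_indeps" and B: "B \<in> enc_indeps" and "card A < card B"
  then have "card (en ` A) < card (en ` B)" by (simp add: en_card)
  then obtain x where "x \<in> en ` B - en ` A" "insert x (en ` A) \<in> \<I>"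
    using matroid_exchange[OF M, of "en ` A" "en ` B"] A B by auto
  then obtain b where "b \<in> B - A" "en ` insert b A \<in> \<I>" by auto
  then show "\<exists>x\<in>B - A. insert x A \<in> enc_indeps" using A B by (intro bexI[of _ b]) auto
qed auto

lemma matroid_rank_encode:
  assumes M: "matroid X \<I>"
  shows "matroid_rank enc_indeps = matroid_rank \<I>"
proof -
  have "card ` enc_indeps = card ` \<I>"
  proof
    show "card ` enc_indeps \<subseteq> card ` \<I>"
    proof clarify
      fix S assume "S \<subseteq> {..<ground_size enc}" "indep enc S"
      then show "card S \<in> card ` \<I>" using en_card[of S] by (intro image_eqI[of _ _ "en ` S"]) auto
    qed
    show "card ` \<I> \<subseteq> card ` enc_indeps"
    proof clarify
      fix S assume S: "S \<in> \<I>"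
      then have "S \<subseteq> X" by (rule matroid_subset[OF M])
      from en_preimage[OF this] obtain S' where "S' \<subseteq> {..<card X}" "en ` S' = S"
        by (elim exE conjE)
      then show "card S \<in> card ` enc_indeps"
        using S en_card[of S'] by (intro image_eqI[of _ _ S']) simp_all
    qed
  qed
  then show ?thesis by (simp add: matroid_rank_def)
qed

lemma dispersion_encode: "S \<subseteq> {..<card X} \<Longrightarrow> dispersion (dist_entry enc) S = dispersion d (en ` S)"
  by (simp add: dispersion_def sum.reindex[OF en_inj])

lemma sum_marginal_encode:
  assumes "S \<subseteq> {..<card X}"
  shows "(\<Sum>i\<in>S. marginal {..<card X} (value_of enc) i) = (\<Sum>x\<in>en ` S. marginal X f x)"
proof -
  have im: "en ` {..<card X} = X" using en by (simp add: bij_betw_def)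
  have "en ` ({..<card X} - {i}) = X - {en i}" if "i \<in> S" for i
    using that assms im by (subst inj_on_image_set_diff[OF en_inj[OF order_refl]]) auto
  then show ?thesis
    unfolding sum.reindex[OF en_inj[OF assms]] by (intro sum.cong) (auto simp: marginal_def im)
qed

end

theorem theorem3:
  fixes \<epsilon> :: real
  assumes "\<epsilon> > 0"
  shows "\<exists>(alg :: com) (p :: nat poly).
    \<forall>(X :: 'a set) (d :: 'a \<Rightarrow> 'a \<Rightarrow> real) (f :: 'a set \<Rightarrow> real) (\<I> :: 'a set set) (en :: nat \<Rightarrow> 'a).
      finite X \<longrightarrow>
      distance_on X d \<longrightarrow> negative_type_on X d \<longrightarrow>
      (\<forall>A\<subseteq>X. 0 \<le> f A) \<longrightarrow> mono_on (Pow X) f \<longrightarrow> submodular_on X f \<longrightarrow>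
      matroid X \<I> \<longrightarrow>
      bij_betw en {..<card X} X \<longrightarrow>
      (\<exists>S. returns_within alg (encode en X d f \<I>) (poly p (card X)) S \<and>
        (let A = en ` S; g = (\<lambda>B. dispersion d B + f B);
             k = real (matroid_rank \<I>); c = curvature X f
         in A \<in> \<I> \<and>
            (\<forall>OPT. is_arg_max g (\<lambda>B. B \<in> \<I>) OPT \<longrightarrow>
               (let lam_d = dispersion d OPT / g OPT; lam_f = f OPT / g OPT
                in g A \<ge> (1 - lam_d * (4 / k) - lam_f * (c / exp 1) - \<epsilon>) * g OPT \<and>
                   1 - lam_d * (4 / k) - lam_f * (c / exp 1) - \<epsilon>
                     \<ge> 1 - max (4 / k) (c / exp 1) - \<epsilon>))))"
proof -
  \<comment> \<open>Half of \<open>\<epsilon>\<close> pays for the excess of \<open>decay m\<close>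
    over 1/e, the other half for stopping after finitely many steps. Both \<open>m\<close> and
    \<open>c\<close> depend on \<open>\<epsilon>\<close> alone, so one program serves all
    instances.\<close>
  have "\<forall>\<^sub>F m in sequentially. decay m < 1 / exp 1 + \<epsilon> / 2"
    using decay_limit assms by (intro order_tendstoD) auto
  then have "\<forall>\<^sub>F m in sequentially. decay m < 1 / exp 1 + \<epsilon> / 2 \<and> 0 < m"
    using eventually_gt_at_top by (rule eventually_conj)
  then obtain m where m: "decay m < 1 / exp 1 + \<epsilon> / 2" "0 < m"
    using eventually_happens by force
  obtain c where c: "real (m + 1) / (\<epsilon> / 2) < real c"
    using reals_Archimedean2 by blast
  obtain p :: "nat poly" where p: "\<And>n. local_search_time m c n = poly p n"
    using polynomial_local_search_time[of m c] unfolding polynomial_def by blast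
  show ?thesis
  proof (intro exI[of _ "local_search m c"] exI[of _ p] allI impI, goal_cases)
    case (1 X d f \<I> en)
    note fin = 1(1) and dist = 1(2,3) and f0 = 1(4)[rule_format] and mono = 1(5) and sm = 1(6)
      and M = 1(7) and en = 1(8)
    let ?P = "encode en X d f \<I>"
    let ?Y = "{..<card X}"
    let ?J = "{S. S \<subseteq> {..<ground_size ?P} \<and> indep ?P S}"
    let ?g = "\<lambda>B. dispersion d B + f B"
    let ?k = "real (matroid_rank \<I>)"
    let ?c = "curvature X f"
    interpret indexed_problem ?P m
      by unfold_locales (use m matroid_encode[OF en M] in auto)
    obtain t s where s: "exec ?P (local_search m c) initial_state t s" "t \<le> poly p (card X)"
        "base_labels (labels ?P s 0)"
        and result: "\<And>\<Theta> \<delta>. ascent \<Theta> \<delta> \<Longrightarrow> \<Theta> \<le> val (labels ?P s 0) \<or>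
          (\<exists>\<sigma>. base_labels \<sigma> \<and> real (c * n) * \<delta> \<le> pot \<sigma>)"
      using runs_local_search[of c] unfolding runs_def p by auto
    define S where "S = array_set ?P s 0"
    define A where "A = en ` S"
    have S: "S = part {..<n} (labels ?P s 0) {1..m}"
      unfolding S_def using base_labels_le[OF s(3)] by (rule array_set_part)
    then have SJ: "S \<in> ?J" using s(3) by (simp add: labelled_base_def)
    then have SY: "S \<subseteq> ?Y" and A: "A \<in> \<I>" by (auto simp: A_def)
    then have AX: "A \<subseteq> X" by (intro matroid_subset[OF M])
    have valA: "val (labels ?P s 0) = ?g A"
      unfolding val_def S[symmetric] A_def using dispersion_encode[OF en SY, of d f \<I>] by simp
    have g0: "0 \<le> ?g B" "0 \<le> dispersion d B" "0 \<le> f B" if "B \<in> \<I>" for B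
    proof -
      have "B \<subseteq> X" using that by (rule matroid_subset[OF M])
      then show "0 \<le> dispersion d B" "0 \<le> f B" using dispersion_nonneg[OF dist(1)] f0 by auto
      then show "0 \<le> ?g B" by simp
    qed
    note curv = curvature_bounds[OF fin mono sm]
    have bounds: "(1 - dispersion d OPT / ?g OPT * (4 / ?k) - f OPT / ?g OPT * (?c / exp 1) - \<epsilon>) * ?g OPT \<le> ?g A \<and>
        1 - max (4 / ?k) (?c / exp 1) - \<epsilon>
          \<le> 1 - dispersion d OPT / ?g OPT * (4 / ?k) - f OPT / ?g OPT * (?c / exp 1) - \<epsilon>"
      if opt: "is_arg_max ?g (\<lambda>B. B \<in> \<I>) OPT" for OPT
    proof
      have O: "OPT \<in> \<I>" and max: "\<And>B. B \<in> \<I> \<Longrightarrow> ?g B \<le> ?g OPT"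
        using opt by (auto simp: is_arg_max_def not_less)
      have OX: "OPT \<subseteq> X" using O by (rule matroid_subset[OF M])
      define G where "G = ?g OPT"
      define ld where "ld = dispersion d OPT / G"
      define lf where "lf = f OPT / G"
      have G0: "0 \<le> G" using g0[OF O] by (simp add: G_def)
      \<comment> \<open>The two fractions sum to 1, except that division by zero makes both 0 if
        \<open>G\<close> is 0.\<close>
      have lam: "0 \<le> ld" "0 \<le> lf" "ld + lf \<le> 1"
        using g0[OF O] G0 by (auto simp: ld_def lf_def simp flip: add_divide_distrib) (simp add: G_def)
      have "ld * (4 / ?k) + lf * (?c / exp 1) \<le> ld * max (4 / ?k) (?c / exp 1) + lf * max (4 / ?k) (?c / exp 1)"
        using lam by (intro add_mono mult_left_mono) auto
      also have "\<dots> = (ld + lf) * max (4 / ?k) (?c / exp 1)" by (simp add: algebra_simps)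
      also have "\<dots> \<le> 1 * max (4 / ?k) (?c / exp 1)"
        using lam by (intro mult_right_mono) (auto simp: le_max_iff_disj)
      finally show "1 - max (4 / ?k) (?c / exp 1) - \<epsilon>
          \<le> 1 - dispersion d OPT / ?g OPT * (4 / ?k) - f OPT / ?g OPT * (?c / exp 1) - \<epsilon>"
        unfolding ld_def lf_def G_def by linarith
      have "(1 - ld * (4 / ?k) - lf * (?c / exp 1) - \<epsilon>) * G \<le> ?g A"
      \<comment> \<open>In both degenerate cases the output is optimal: for \<open>G = 0\<close> by
        nonnegativity, for rank 0 because the empty set is the only independent one.\<close>
      proof (cases "G = 0 \<or> matroid_rank \<I> = 0")
        case True
        have "G \<le> ?g A"
        proof (cases "G = 0")
          case False
          then have "matroid_rank \<I> = 0" using True by simp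
          then have "card A = 0" "card OPT = 0"
            using matroid_rank_ge[OF M A] matroid_rank_ge[OF M O] by auto
          then have "A = {}" "OPT = {}" using finite_subset[OF AX fin] finite_subset[OF OX fin] by simp_all
          then show ?thesis by (simp add: G_def)
        qed (use g0[OF A] in simp)
        moreover have "0 \<le> ld * (4 / ?k) + lf * (?c / exp 1) + \<epsilon>"
          using lam curv(1) assms by simp
        then have "(1 - ld * (4 / ?k) - lf * (?c / exp 1) - \<epsilon>) * G \<le> 1 * G"
          using G0 by (intro mult_right_mono) auto
        ultimately show ?thesis by simp
      next
        case False
        then have G: "0 < G" and k0: "0 < matroid_rank \<I>" using G0 by auto
        \<comment> \<open>\<open>OPT\<close> need not be a base. A base above it has no larger
          objective, and since dispersion and \<open>f\<close> are both monotone, each of them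
          agrees on the two sets.\<close>
        obtain R where "R \<in> \<I>" "card R = matroid_rank \<I>" using matroid_rank_attained[OF M] by blast
        then obtain B where B: "B \<in> \<I>" "OPT \<subseteq> B" "card B = matroid_rank \<I>"
          using matroid_augment[OF M O] matroid_rank_ge[OF M O] by metis
        have BX: "B \<subseteq> X" using B(1) by (rule matroid_subset[OF M])
        have "dispersion d OPT \<le> dispersion d B" by (rule dispersion_mono[OF dist(1) fin B(2) BX])
        moreover have "f OPT \<le> f B" by (rule mono_onD[OF mono]) (use OX BX B(2) in auto)
        ultimately have eq: "dispersion d B = dispersion d OPT" "f B = f OPT"
          using max[OF B(1)] by auto
        obtain B' where B': "B' \<subseteq> ?Y" "en ` B' = B" using en_preimage[OF en BX] by (elim exE conjE)
        have rank: "matroid_rank ?J = matroid_rank \<I>" by (rule matroid_rank_encode[OF en M])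
        have c2: "real (m + 1) < real c * (\<epsilon> / 2)" using c assms by (simp add: field_simps)
        have guarantee: "(1 - 4 / (?k + 2)) * dispersion (dist_entry ?P) B' + (1 - decay m) * value_of ?P B'
            + decay m * (\<Sum>x\<in>B'. marginal {..<n} (value_of ?P) x) + decay m * value_of ?P {} - \<epsilon> / 2 * G
            \<le> val (labels ?P s 0)"
          unfolding rank[symmetric]
        proof (rule local_search_guarantee[where c = c])
          show "distance_on {..<n} (dist_entry ?P)" "negative_type_on {..<n} (dist_entry ?P)"
            using distance_on_encode[OF en dist(1)] negative_type_on_encode[OF en dist(2)]
            by (simp_all only: encode_simps)
          show "mono_on (Pow {..<n}) (value_of ?P)" "submodular_on {..<n} (value_of ?P)"
            using mono_on_encode[OF en mono] submodular_on_encode[OF en sm] by (simp_all only: encode_simps)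
          show "0 \<le> value_of ?P C" if "C \<subseteq> {..<n}" for C
            using f0 en_subset[OF en] that by simp
          show "B' \<in> ?J" "card B' = matroid_rank ?J"
            using B' B en_card[OF en B'(1)] rank by auto
          show "0 < matroid_rank ?J" using k0 rank by simp
          show "dispersion (dist_entry ?P) C + value_of ?P C \<le> G" if "C \<in> ?J" for C
          proof -
            have "C \<subseteq> ?Y" "en ` C \<in> \<I>" using that by auto
            then show ?thesis
              unfolding G_def using max[of "en ` C"] dispersion_encode[OF en, of C d f \<I>] by simp
          qed
        qed (use G c2 assms result in auto)
        let ?q = "decay m"
        have marg: "(\<Sum>x\<in>B'. marginal {..<n} (value_of ?P) x) = (\<Sum>x\<in>B. marginal X f x)"
          using sum_marginal_encode[OF en B'(1), of d f \<I>] B'(2) by simp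
        have disp: "dispersion (dist_entry ?P) B' = dispersion d B"
          using dispersion_encode[OF en B'(1), of d f \<I>] B'(2) by simp
        have val_enc: "value_of ?P B' = f B" "value_of ?P {} = f {}" using B'(2) by simp_all
        have est: "(1 - 4 / (?k + 2)) * dispersion d B + (1 - ?q) * f B
            + ?q * (\<Sum>x\<in>B. marginal X f x) + ?q * f {} - \<epsilon> / 2 * G \<le> ?g A"
          using guarantee unfolding disp val_enc marg valA .
        have q: "0 \<le> ?q" by (rule decay_bounds)
        have dB: "0 \<le> dispersion d B" "0 \<le> f B" using g0[OF B(1)] by auto
        have "4 / (?k + 2) * dispersion d B \<le> 4 / ?k * dispersion d B"
          using k0 dB by (intro mult_right_mono divide_left_mono) auto
        moreover have "(1 - ?c) * (f B - f {}) \<le> (\<Sum>x\<in>B. marginal X f x)"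
          by (rule sum_marginal_ge_curvature[OF fin mono sm BX])
        then have "?q * ((1 - ?c) * (f B - f {})) \<le> ?q * (\<Sum>x\<in>B. marginal X f x)"
          using q by (rule mult_left_mono)
        \<comment> \<open>The f({}) subtracted in the curvature bound is covered by the term
          \<open>?q * f {}\<close> of \<open>est\<close>; this product is what is left over.\<close>
        moreover have "0 \<le> ?q * (?c * f {})" using q curv(1) f0[of "{}"] by simp
        \<comment> \<open>Here the first half of \<open>\<epsilon>\<close> is spent: the excess of
          \<open>?q\<close> over 1/e multiplies only \<open>?c * f B\<close>, which is at most
          \<open>G\<close>.\<close>
        moreover have "?q * (?c * f B) \<le> (1 / exp 1 + \<epsilon> / 2) * (?c * f B)"
          using m(1) curv(1) dB by (intro mult_right_mono) auto
        moreover have "?c * f B \<le> G"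
        proof -
          have "?c * f B \<le> f B" using curv(1,2) dB by (intro mult_left_le_one_le) auto
          then show ?thesis using dB max[OF B(1)] by (simp add: G_def)
        qed
        then have "\<epsilon> / 2 * (?c * f B) \<le> \<epsilon> / 2 * G" using assms by (intro mult_left_mono) auto
        ultimately have "(1 - 4 / ?k) * dispersion d B + (1 - ?c / exp 1) * f B - \<epsilon> * G \<le> ?g A"
          using est by (simp add: algebra_simps)
        moreover have lamG: "ld * G = dispersion d B" "lf * G = f B"
          using G by (simp_all add: ld_def lf_def eq)
        have "(1 - ld * (4 / ?k) - lf * (?c / exp 1) - \<epsilon>) * G
            = G - 4 / ?k * (ld * G) - ?c / exp 1 * (lf * G) - \<epsilon> * G"
          by (simp add: algebra_simps)
        then have "(1 - ld * (4 / ?k) - lf * (?c / exp 1) - \<epsilon>) * G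
            = (1 - 4 / ?k) * dispersion d B + (1 - ?c / exp 1) * f B - \<epsilon> * G"
          unfolding lamG by (simp add: G_def eq algebra_simps)
        ultimately show ?thesis by simp
      qed
      then show "(1 - dispersion d OPT / ?g OPT * (4 / ?k) - f OPT / ?g OPT * (?c / exp 1) - \<epsilon>) * ?g OPT \<le> ?g A"
        unfolding ld_def lf_def G_def .
    qed
    have "returns_within (local_search m c) ?P (poly p (card X)) S"
      unfolding returns_within_def S_def using s(1,2) by blast
    then show ?case
      unfolding Let_def using A bounds unfolding A_def by blast
  qed
qed

end
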